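(* Let $X$ be a transient Markov chain on $\mathbf{Z}^d$, independent of the fractal percolation, and let $p\in(0,1]$. For every nonrandom $F\subseteq\mathbf{Z}^d$ and every $a\in\mathbf{Z}^d$, $$\tfrac12\,c_p(F;a)\ \le\ \mathbb{P}^a\{X_n\in\Pi_p\cap F\text{ for some }n\ge0\}\ \le\ 128\,c_p(F;a).$$
   Context: For integers $k\ge 0$ let $\mathcal{V}_k:=[-2^k,2^k)^d\subset\mathbf{R}^d$, $\mathcal{S}_0:=\mathcal{V}_0$ and $\mathcal{S}_{k+1}:=\mathcal{V}_{k+1}\setminus\mathcal{V}_k$. For $n\in\mathbf{Z}$, $\mathcal{D}_n$ denotes the set of dyadic cubes $\prod_{i=1}^d[j_i2^n,(j_i+1)2^n)$ with $(j_1,\dots,j_d)\in\mathbf{Z}^d$. Macroscopic fractal percolation: on a probability space $(\Omega,\mathcal{F},\mathbb{P})$, for each integer $k\ge0$ let $\{U_k(Q)\}$ be i.i.d. Uniform$(0,1)$ random variables indexed by the dyadic cubes $Q\subseteq\mathcal{V}_k$ with $Q\in\mathcal{D}_j$ for some $0\le j\le k$, the families for different $k$ being independent. For $x\in\mathcal{V}_k\cap\mathbf{Z}^d$ and $1\le i\le k+1$ let $Q^{(k)}_i(x)$ be the unique cube of $\mathcal{D}_{k+1-i}$ containing $x$. For $p\in(0,1]$, $\Pi_p\subseteq\mathbf{R}^d$ is the union, over all $k\ge0$ and all $x\in\mathbf{Z}^d\cap\mathcal{S}_k$ such that $U_k(Q^{(k)}_i(x))<p$ for every $i=1,\dots,k+1$,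 of the unit cubes $[x_1,x_1+1)\times\cdots\times[x_d,x_d+1)$. For $x,y\in\mathbf{Z}^d\cap\mathcal{S}_k$ define $\mathrm{d}(x,y):=\#\{i\in\{1,\dots,k+1\}:Q^{(k)}_i(x)=Q^{(k)}_i(y)\}$. Write $x\leftrightarrow y$ if $x,y$ lie in the same shell $\mathcal{S}_k$, and $x\not\leftrightarrow y$ otherwise. Markov chain setting: $X=\{X_n\}_{n\ge0}$ is a Markov chain on $\mathbf{Z}^d$ with laws $P^a$ under which $X_0=a$; its Green function $g(a,x):=\sum_{n\ge0}P^a\{X_n=x\}$ is finite for all $a,x$ (transience). $X$ and the percolation are independent, and $\mathbb{P}^a:=P^a\times\mathbb{P}$. For a probability measure $\mu$ on $\mathbf{Z}^d$ (write $\mu(z):=\mu(\{z\})$), $a\in\mathbf{Z}^d$ and $p\in(0,1]$ define $I(\mu;a):=\sum\sum_{x,y:\,x\not\leftrightarrow y}\frac{g(x,y)}{g(a,y)}\mu(x)\mu(y)$ and $I_p(\mu;a):=\sum\sum_{x,y:\,x\leftrightarrow y}\frac{g(x,y)}{g(a,y)}p^{-\mathrm{d}(x,y)}\mu(x)\mu(y)$, with conventions $c/0=\infty$ for $c>0$ and $0/0=0$. The Martin $p$-capacity of $F\subseteq\mathbf{Z}^d$ is $c_p(F;a):=\sup_{F_0\subseteq F,\ F_0\text{ finite}}\big[\inf_{\mu\in M_1(F_0)}\{I(\mu;a)+I_p(\mu;a)\}\big]^{-1}$, where $M_1(F_0)$ is the set of probability measures on $F_0$ (and $1/\infty=0$,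 $1/0=\infty$, $\inf\varnothing=\infty$). *)

theory Defs
  imports "HOL-Probability.Probability"
begin

text \<open>Lattice points of Z^d are modelled as int^'d, points of R^d as real^'d.
  A dyadic cube of D_n (n >= 0) is encoded by the pair (n, j) with j in Z^d,
  standing for prod_i [j_i 2^n, (j_i+1) 2^n).\<close>

definition latV :: "nat \<Rightarrow> (int^'d) set" where
  "latV k = {x. \<forall>i. - (2^k) \<le> x$i \<and> x$i < 2^k}"

fun latS :: "nat \<Rightarrow> (int^'d) set" where
  "latS 0 = latV 0"
| "latS (Suc k) = latV (Suc k) - latV k"

definition cube_idx :: "nat \<Rightarrow> int^'d \<Rightarrow> int^'d" where
  "cube_idx m x = (\<chi> i. (x$i) div 2^m)"

text \<open>Index set of the random variables U_k(Q): triples (k, j, c) with Q in D_j,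
  0 <= j <= k, Q a subset of V_k.\<close>
definition perc_index :: "(nat \<times> nat \<times> (int^'d)) set" where
  "perc_index = {(k, j, c). j \<le> k \<and> (\<forall>i. - (2^(k-j)) \<le> c$i \<and> c$i < 2^(k-j))}"

definition unit_cube :: "int^'d \<Rightarrow> (real^'d) set" where
  "unit_cube x = {y. \<forall>i. real_of_int (x$i) \<le> y$i \<and> y$i < real_of_int (x$i) + 1}"

definition lat_embed :: "int^'d \<Rightarrow> real^'d" where
  "lat_embed x = (\<chi> i. real_of_int (x$i))"

text \<open>The random set Pi_p (for the sample point w); Q^{(k)}_i(x) is the cube of level k+1-i
  containing x.\<close>
definition frac_perc ::
  "real \<Rightarrow> (nat \<Rightarrow> nat \<Rightarrow> int^'d \<Rightarrow> 'w \<Rightarrow> real) \<Rightarrow> 'w \<Rightarrow> (real^'d) set" where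
  "frac_perc p U w = \<Union> {unit_cube x | x k. x \<in> latS k \<and>
      (\<forall>i\<in>{1..k+1}. U k (k+1-i) (cube_idx (k+1-i) x) w < p)}"

definition same_shell :: "int^'d \<Rightarrow> int^'d \<Rightarrow> bool" where
  "same_shell x y = (\<exists>k. x \<in> latS k \<and> y \<in> latS k)"

definition shell_of :: "int^'d \<Rightarrow> nat" where
  "shell_of x = (THE k. x \<in> latS k)"

definition tree_dist :: "int^'d \<Rightarrow> int^'d \<Rightarrow> nat" where
  "tree_dist x y = (let k = shell_of x in
     card {i\<in>{1..k+1}. cube_idx (k+1-i) x = cube_idx (k+1-i) y})"

fun kstep :: "('a \<Rightarrow> 'a pmf) \<Rightarrow> nat \<Rightarrow> 'a \<Rightarrow> 'a pmf" where
  "kstep K 0 a = return_pmf a"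
| "kstep K (Suc n) a = bind_pmf (kstep K n a) K"

definition green :: "('a \<Rightarrow> 'a pmf) \<Rightarrow> 'a \<Rightarrow> 'a \<Rightarrow> ennreal" where
  "green K a x = (\<Sum>n. ennreal (pmf (kstep K n a) x))"

text \<open>Energies; ennreal arithmetic gives c/0 = \<infinity> (c>0), 0/0 = 0.\<close>
definition energy_I :: "(int^'d \<Rightarrow> (int^'d) pmf) \<Rightarrow> (int^'d) pmf \<Rightarrow> int^'d \<Rightarrow> (int^'d) set \<Rightarrow> ennreal" where
  "energy_I K \<mu> a F0 = (\<Sum>x\<in>F0. \<Sum>y\<in>F0. if \<not> same_shell x y then
      green K x y / green K a y * ennreal (pmf \<mu> x) * ennreal (pmf \<mu> y) else 0)"

definition energy_Ip :: "real \<Rightarrow> (int^'d \<Rightarrow> (int^'d) pmf) \<Rightarrow> (int^'d) pmf \<Rightarrow> int^'d \<Rightarrow> (int^'d) set \<Rightarrow> ennreal" where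
  "energy_Ip p K \<mu> a F0 = (\<Sum>x\<in>F0. \<Sum>y\<in>F0. if same_shell x y then
      green K x y / green K a y * ennreal (1 / p ^ tree_dist x y) * ennreal (pmf \<mu> x) * ennreal (pmf \<mu> y) else 0)"

definition martin_cap :: "real \<Rightarrow> (int^'d \<Rightarrow> (int^'d) pmf) \<Rightarrow> (int^'d) set \<Rightarrow> int^'d \<Rightarrow> ennreal" where
  "martin_cap p K F a = (SUP F0\<in>{F0. F0 \<subseteq> F \<and> finite F0}.
      inverse (INF \<mu>\<in>{\<mu>. set_pmf \<mu> \<subseteq> F0}. energy_I K \<mu> a F0 + energy_Ip p K \<mu> a F0))"

end

theory Submission
  imports Defs "HOL-Library.List_Lexorder"
begin

text \<open>
  Encode the percolation on a finite target set by the random set \<open>r\<close> of retained cubes; a point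
  survives iff all its cubes lie in \<open>r\<close>. The lower bound is the second moment method for
  \<open>Z = \<Sum>\<^sub>y N\<^sub>y \<mu>(y) / (g(a,y) P(y survives))\<close> over surviving \<open>y\<close>, where \<open>N\<^sub>y\<close> counts visits of the
  chain: \<open>E Z = 1\<close>, and the Markov property bounds \<open>E Z\<^sup>2\<close> by twice the energy of \<open>\<mu>\<close>.

  For the upper bound let \<open>\<rho>\<close> be the first surviving target point hit by the chain and \<open>\<mu>\<close> its law
  given a hit. This is a stopping rule for the chain, but not for the percolation. Order the points so
  that each cube is an interval, project \<open>1{\<rho> = x}\<close> on the percolation up to \<open>x\<close> for a fixed path, and
  let \<open>B\<close> be the sum over \<open>x\<close>. A dual form of Doob's inequality gives \<open>E B\<^sup>2 \<le> 4 P(hit)\<close>, while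
  \<open>E (Z B)\<close> is at least \<open>P(hit)\<close> times the part of the energy carried by \<open>x \<le> y\<close>. Doing this for the
  order and its converse yields \<open>P(hit) \<cdot> energy \<le> 32\<close>.
\<close>

section \<open>Bernoulli percolation on a finite set of sites\<close>

text \<open>This stands in for Cauchy-Schwarz throughout: it is additive on the right, so it can be
  averaged over path and percolation in turn, and a free factor is optimised only at the end. An
  infinite argument makes the right-hand side infinite.\<close>

lemma ennreal_two_mult_le_squares:
  fixes z u :: ennreal
  shows "2 * (z * u) \<le> z^2 + u^2"
proof (cases z; cases u)
  fix r s :: real assume "0 \<le> r" "z = ennreal r" "0 \<le> s" "u = ennreal s"
  moreover have "2 * (r * s) \<le> r^2 + s^2" using sum_squares_bound[of r s] by simp
  ultimately show ?thesis
    by (simp add: ennreal_mult[symmetric] ennreal_power ennreal_plus[symmetric]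
        ennreal_numeral[symmetric] del: ennreal_plus ennreal_numeral)
qed (auto simp: power2_eq_square)

text \<open>For \<open>r \<subseteq> C\<close> this is the probability that \<open>r\<close> is
  exactly the set of retained sites when each site of \<open>C\<close> is kept independently with
  probability \<open>p\<close>. Finite sums over \<open>Pow C\<close> thus replace integrals over
  the percolation.\<close>

definition bern_weight :: "real \<Rightarrow> 'c set \<Rightarrow> 'c set \<Rightarrow> real" where
  "bern_weight p C r = (\<Prod>c\<in>C. if c \<in> r then p else 1 - p)"

definition bern_mean :: "real \<Rightarrow> 'c set \<Rightarrow> ('c set \<Rightarrow> real) \<Rightarrow> real" where
  "bern_mean p C f = (\<Sum>r\<in>Pow C. bern_weight p C r * f r)"

text \<open>The conditional expectation of \<open>f\<close> given the state of the sites in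
  \<open>S\<close>: these keep their state from \<open>r\<close>, and the rest of \<open>C\<close>
  is averaged out.\<close>

definition bern_cond :: "real \<Rightarrow> 'c set \<Rightarrow> 'c set \<Rightarrow> ('c set \<Rightarrow> real) \<Rightarrow> 'c set \<Rightarrow> real" where
  "bern_cond p C S f r = bern_mean p (C - S) (\<lambda>t. f (r \<inter> S \<union> t))"

lemma bern_weight_nonneg: "0 \<le> p \<Longrightarrow> p \<le> 1 \<Longrightarrow> 0 \<le> bern_weight p C r"
  by (auto simp: bern_weight_def intro!: prod_nonneg)

lemma bern_mean_mono:
  assumes "0 \<le> p" "p \<le> 1" "\<And>r. r \<subseteq> C \<Longrightarrow> f r \<le> g r"
  shows "bern_mean p C f \<le> bern_mean p C g"
  unfolding bern_mean_def using assms
  by (intro sum_mono mult_left_mono bern_weight_nonneg) auto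

lemma bern_mean_nonneg:
  assumes "0 \<le> p" "p \<le> 1" "\<And>r. r \<subseteq> C \<Longrightarrow> 0 \<le> f r"
  shows "0 \<le> bern_mean p C f"
  unfolding bern_mean_def using assms
  by (intro sum_nonneg mult_nonneg_nonneg bern_weight_nonneg) auto

lemma bern_mean_cong:
  assumes "\<And>r. r \<subseteq> C \<Longrightarrow> f r = g r"
  shows "bern_mean p C f = bern_mean p C g"
  unfolding bern_mean_def using assms by (intro sum.cong) auto

lemma bern_mean_sum: "bern_mean p C (\<lambda>r. \<Sum>i\<in>I. f i r) = (\<Sum>i\<in>I. bern_mean p C (f i))"
  unfolding bern_mean_def by (simp add: sum_distrib_left) (rule sum.swap)

lemma bern_mean_add: "bern_mean p C (\<lambda>r. f r + g r) = bern_mean p C f + bern_mean p C g"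
  unfolding bern_mean_def by (simp add: algebra_simps sum.distrib)

lemma bern_mean_cmult: "bern_mean p C (\<lambda>r. c * f r) = c * bern_mean p C f"
  unfolding bern_mean_def by (simp add: algebra_simps sum_distrib_left)

text \<open>Fubini for the product measure: a configuration on \<open>C\<close> is a pair of
  configurations on \<open>S\<close> and on \<open>C - S\<close>, and its weight factorises.\<close>

lemma bern_mean_split:
  assumes "finite C" "S \<subseteq> C"
  shows "bern_mean p C f = bern_mean p S (\<lambda>s. bern_mean p (C - S) (\<lambda>t. f (s \<union> t)))"
proof -
  have w: "bern_weight p C (s \<union> t) = bern_weight p S s * bern_weight p (C - S) t"
    if "s \<subseteq> S" "t \<subseteq> C - S" for s t
  proof -
    have "bern_weight p C (s \<union> t) =
        (\<Prod>c\<in>S. if c \<in> s \<union> t then p else 1 - p) * (\<Prod>c\<in>C - S. if c \<in> s \<union> t then p else 1 - p)"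
      unfolding bern_weight_def using assms by (subst prod.subset_diff[of S C]) auto
    also have "(\<Prod>c\<in>S. if c \<in> s \<union> t then p else 1 - p) = bern_weight p S s"
      unfolding bern_weight_def using that by (intro prod.cong) auto
    also have "(\<Prod>c\<in>C - S. if c \<in> s \<union> t then p else 1 - p) = bern_weight p (C - S) t"
      unfolding bern_weight_def using that by (intro prod.cong) auto
    finally show ?thesis .
  qed
  have "bern_mean p C f = (\<Sum>(s, t)\<in>Pow S \<times> Pow (C - S). bern_weight p C (s \<union> t) * f (s \<union> t))"
    unfolding bern_mean_def using assms
    by (intro sum.reindex_bij_witness[of _ "\<lambda>(s, t). s \<union> t" "\<lambda>r. (r \<inter> S, r - S)"])
      (auto simp: Int_Diff_Un)
  also have "\<dots> = (\<Sum>(s, t)\<in>Pow S \<times> Pow (C - S).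
      bern_weight p S s * (bern_weight p (C - S) t * f (s \<union> t)))"
    using w by (intro sum.cong) auto
  also have "\<dots> = bern_mean p S (\<lambda>s. bern_mean p (C - S) (\<lambda>t. f (s \<union> t)))"
    unfolding bern_mean_def by (simp add: sum.cartesian_product[symmetric] sum_distrib_left)
  finally show ?thesis .
qed

lemma sum_bern_weight:
  assumes "finite C"
  shows "(\<Sum>r\<in>Pow C. bern_weight p C r) = 1"
  using assms
proof induction
  case empty
  then show ?case by (simp add: bern_weight_def)
next
  case (insert c C)
  have "bern_mean p (insert c C) (\<lambda>_. 1) =
      bern_mean p {c} (\<lambda>s. bern_mean p (insert c C - {c}) (\<lambda>t. 1))"
    using insert by (intro bern_mean_split) auto
  also have "bern_mean p (insert c C - {c}) (\<lambda>t. 1) = 1"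
    using insert by (simp add: bern_mean_def)
  also have "bern_mean p {c} (\<lambda>s. 1) = 1"
    by (simp add: bern_mean_def bern_weight_def Pow_insert)
  finally show ?case by (simp add: bern_mean_def)
qed

lemma bern_mean_const: "finite C \<Longrightarrow> bern_mean p C (\<lambda>_. c) = c"
  by (simp add: bern_mean_def sum_distrib_right[symmetric] sum_bern_weight)

text \<open>Independence: the hypothesis on \<open>g\<close> says that \<open>g\<close> does not
  look at the sites of \<open>D\<close>.\<close>

lemma bern_mean_superset_mult:
  assumes "finite C" "D \<subseteq> C" and g: "\<And>r. r \<subseteq> C \<Longrightarrow> g r = g (r - D)"
  shows "bern_mean p C (\<lambda>r. of_bool (D \<subseteq> r) * g r) = p ^ card D * bern_mean p C g"
proof -
  have fin: "finite D" "finite (C - D)" using assms finite_subset by auto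
  have split: "bern_mean p C h = bern_mean p (C - D) (\<lambda>s. bern_mean p D (\<lambda>t. h (s \<union> t)))" for h
    using bern_mean_split[of C "C - D" p h] assms(1,2) by (simp add: double_diff)
  have gs: "g (s \<union> t) = g s" if "s \<subseteq> C - D" "t \<subseteq> D" for s t
  proof -
    have "s \<union> t \<subseteq> C" "s \<union> t - D = s" using that assms(2) by auto
    with g[of "s \<union> t"] show ?thesis by simp
  qed
  have D: "bern_mean p D (\<lambda>t. of_bool (D \<subseteq> t)) = p ^ card D"
  proof -
    have "bern_mean p D (\<lambda>t. of_bool (D \<subseteq> t)) = (\<Sum>t\<in>{D}. bern_weight p D t * of_bool (D \<subseteq> t))"
      unfolding bern_mean_def using fin by (intro sum.mono_neutral_right) auto
    also have "\<dots> = p ^ card D" by (simp add: bern_weight_def)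
    finally show ?thesis .
  qed
  have "bern_mean p C (\<lambda>r. of_bool (D \<subseteq> r) * g r) =
      bern_mean p (C - D) (\<lambda>s. bern_mean p D (\<lambda>t. g s * of_bool (D \<subseteq> t)))"
    unfolding split by (intro bern_mean_cong) (use gs in \<open>auto simp: Un_absorb1 subset_iff\<close>)
  also have "\<dots> = p ^ card D * bern_mean p (C - D) g"
    by (simp add: bern_mean_cmult D mult.commute[of _ "p ^ card D"])
  also have "bern_mean p (C - D) g = bern_mean p (C - D) (\<lambda>s. bern_mean p D (\<lambda>t. g s))"
    by (simp add: bern_mean_const fin)
  also have "\<dots> = bern_mean p C g"
    unfolding split by (intro bern_mean_cong) (use gs in auto)
  finally show ?thesis .
qed

lemma bern_mean_superset:
  assumes "finite C" "D \<subseteq> C"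
  shows "bern_mean p C (\<lambda>r. of_bool (D \<subseteq> r)) = p ^ card D"
  using bern_mean_superset_mult[OF assms, of "\<lambda>_. 1"] assms(1) by (simp add: bern_mean_const)

text \<open>The hypothesis makes \<open>g\<close> a function of the sites in \<open>S\<close>, hence
  constant in the inner mean of \<open>bern_mean_split\<close>. This is the defining property of
  conditional expectation.\<close>

lemma bern_mean_cond_mult:
  assumes "finite C" "S \<subseteq> C" and g: "\<And>r. r \<subseteq> C \<Longrightarrow> g r = g (r \<inter> S)"
  shows "bern_mean p C (\<lambda>r. g r * bern_cond p C S f r) = bern_mean p C (\<lambda>r. g r * f r)"
proof -
  have gs: "g (s \<union> t) = g s" if "s \<subseteq> S" "t \<subseteq> C - S" for s t
  proof -
    have "s \<union> t \<subseteq> C" "(s \<union> t) \<inter> S = s" using that assms(2) by auto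
    with g[of "s \<union> t"] show ?thesis by simp
  qed
  have fin: "finite (C - S)" using assms by auto
  have int: "(s \<union> t) \<inter> S = s" if "s \<subseteq> S" "t \<subseteq> C - S" for s t
    using that by auto
  have "bern_mean p C (\<lambda>r. g r * bern_cond p C S f r) =
      bern_mean p S (\<lambda>s. bern_mean p (C - S) (\<lambda>t. g s * bern_mean p (C - S) (\<lambda>t'. f (s \<union> t'))))"
    unfolding bern_mean_split[OF assms(1,2)] bern_cond_def
    by (intro bern_mean_cong) (simp add: gs int)
  also have "\<dots> = bern_mean p S (\<lambda>s. bern_mean p (C - S) (\<lambda>t. g s * f (s \<union> t)))"
    by (simp add: bern_mean_const fin bern_mean_cmult)
  also have "\<dots> = bern_mean p C (\<lambda>r. g r * f r)"
    unfolding bern_mean_split[OF assms(1,2), of _ "\<lambda>r. g r * f r"]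
    by (intro bern_mean_cong) (simp add: gs)
  finally show ?thesis .
qed

lemma bern_cond_Int: "S \<subseteq> S' \<Longrightarrow> bern_cond p C S f (r \<inter> S') = bern_cond p C S f r"
  by (simp add: bern_cond_def Int_assoc Int_absorb1)

lemma bern_cond_nonneg:
  assumes "0 \<le> p" "p \<le> 1" "\<And>r. 0 \<le> f r"
  shows "0 \<le> bern_cond p C S f r"
  unfolding bern_cond_def using assms by (intro bern_mean_nonneg) auto

section \<open>Percolation explored along an order in which every site occupies an interval of
  points\<close>

locale ordered_percolation =
  fixes p :: real and C :: "'c set" and anc :: "'x \<Rightarrow> 'c set" and A :: "'x set"
    and le :: "'x \<Rightarrow> 'x \<Rightarrow> bool"
  assumes p: "0 \<le> p" "p \<le> 1"
    and finite_C: "finite C" and finite_A: "finite A"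
    and anc_sub: "\<And>x. x \<in> A \<Longrightarrow> anc x \<subseteq> C"
    and le_total: "\<And>x y. x \<in> A \<Longrightarrow> y \<in> A \<Longrightarrow> le x y \<or> le y x"
    and le_trans: "\<And>x y z. x \<in> A \<Longrightarrow> y \<in> A \<Longrightarrow> z \<in> A \<Longrightarrow> le x y \<Longrightarrow> le y z \<Longrightarrow> le x z"
    and le_between: "\<And>x y z. x \<in> A \<Longrightarrow> y \<in> A \<Longrightarrow> z \<in> A \<Longrightarrow> le x y \<Longrightarrow> le y z \<Longrightarrow>
      anc x \<inter> anc z \<subseteq> anc y"
begin

text \<open>What is revealed once the points are explored along \<open>le\<close> up to and
  including \<open>x\<close>. These sets increase along \<open>le\<close> and act as a
  filtration.\<close>

definition past :: "'x \<Rightarrow> 'c set" where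
  "past x = (\<Union>z\<in>{z\<in>A. le z x}. anc z)"

lemma past_sub: "past x \<subseteq> C"
  using anc_sub by (auto simp: past_def)

lemma past_mono: "x \<in> A \<Longrightarrow> y \<in> A \<Longrightarrow> le x y \<Longrightarrow> past x \<subseteq> past y"
  unfolding past_def using le_trans[of _ x y] by blast

lemma anc_sub_past: "x \<in> A \<Longrightarrow> anc x \<subseteq> past x"
  using le_total[of x x] by (auto simp: past_def)

text \<open>A site of \<open>y\<close> already seen at some \<open>z\<close> up to \<open>x\<close>
  lies in \<open>anc x\<close> too, by \<open>le_between\<close>. So the sites that \<open>y\<close>
  adds to \<open>anc x\<close> are fresh, hence independent of everything projected on
  \<open>past x\<close>.\<close>

lemma anc_Diff_past:
  assumes "x \<in> A" "y \<in> A" "le x y"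
  shows "(anc y - anc x) \<inter> past x = {}"
proof -
  have "anc z \<inter> anc y \<subseteq> anc x" if "z \<in> A" "le z x" for z
    using le_between[of z x y] assms that by simp
  then show ?thesis unfolding past_def by blast
qed

text \<open>The dual form of Doob's maximal inequality: it bounds the sum of the projections of
  \<^term>\<open>f x\<close> on the increasing information \<^term>\<open>past x\<close> and needs no stopping argument.\<close>

lemma dual_doob:
  assumes f: "\<And>x r. 0 \<le> f x r"
  shows "bern_mean p C (\<lambda>r. (\<Sum>x\<in>A. bern_cond p C (past x) (f x) r)^2)
    \<le> 4 * bern_mean p C (\<lambda>r. (\<Sum>x\<in>A. f x r)^2)"
proof -
  define b where "b x = bern_cond p C (past x) (f x)" for x
  define B F where "B r = (\<Sum>x\<in>A. b x r)" and "F r = (\<Sum>x\<in>A. f x r)" for r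
  have b0: "0 \<le> b x r" for x r unfolding b_def using p f by (intro bern_cond_nonneg)
  \<comment> \<open>\<open>b x\<close> is determined by \<open>past x\<close>, which is contained in
    \<open>past y\<close>, so the projection in the second factor can be undone.\<close>
  have tower: "bern_mean p C (\<lambda>r. b x r * b y r) = bern_mean p C (\<lambda>r. b x r * f y r)"
    if "x \<in> A" "y \<in> A" "le x y" for x y
    unfolding b_def
    using bern_mean_cond_mult[OF finite_C past_sub[of y], of "bern_cond p C (past x) (f x)" p "f y"]
      bern_cond_Int[OF past_mono[OF that], of p C "f x"] by simp
  have nn: "0 \<le> bern_mean p C (\<lambda>r. b x r * f y r)" for x y
    using p b0 f by (intro bern_mean_nonneg mult_nonneg_nonneg)
  have "bern_mean p C (\<lambda>r. (B r)^2) = (\<Sum>x\<in>A. \<Sum>y\<in>A. bern_mean p C (\<lambda>r. b x r * b y r))"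
    by (simp add: B_def power2_eq_square sum_product bern_mean_sum)
  \<comment> \<open>By \<open>tower\<close>, one of the two terms on the right equals the left one,
    depending on which point comes later; the other is nonnegative.\<close>
  also have "\<dots> \<le> (\<Sum>x\<in>A. \<Sum>y\<in>A. bern_mean p C (\<lambda>r. b x r * f y r) + bern_mean p C (\<lambda>r. b y r * f x r))"
  proof (intro sum_mono)
    fix x y assume xy: "x \<in> A" "y \<in> A"
    show "bern_mean p C (\<lambda>r. b x r * b y r)
        \<le> bern_mean p C (\<lambda>r. b x r * f y r) + bern_mean p C (\<lambda>r. b y r * f x r)"
      using le_total[OF xy] tower[of x y] tower[of y x] xy nn[of x y] nn[of y x]
      by (auto simp: mult.commute[of "b y _" "b x _"])
  qed
  also have "\<dots> = 2 * (\<Sum>x\<in>A. \<Sum>y\<in>A. bern_mean p C (\<lambda>r. b x r * f y r))"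
    by (simp add: sum.distrib sum.swap[of "\<lambda>x y. bern_mean p C (\<lambda>r. b y r * f x r)" A A])
  also have "\<dots> = bern_mean p C (\<lambda>r. 2 * (B r * F r))"
    by (simp add: B_def F_def sum_product bern_mean_sum bern_mean_cmult)
  \<comment> \<open>Half of the mean of \<open>B^2\<close> is absorbed on the left, which leaves the
    factor 4.\<close>
  also have "\<dots> \<le> bern_mean p C (\<lambda>r. 1/2 * (B r)^2 + 2 * (F r)^2)"
  proof (intro bern_mean_mono p)
    fix r
    have "0 \<le> (B r - 2 * F r)^2" by simp
    then show "2 * (B r * F r) \<le> 1/2 * (B r)^2 + 2 * (F r)^2"
      by (simp add: power2_diff)
  qed
  finally show ?thesis
    unfolding bern_mean_add bern_mean_cmult by (simp add: B_def F_def b_def)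
qed

text \<open>The projection of \<open>f\<close> vanishes unless \<open>anc x\<close> is retained.
  Where it does not vanish, survival of \<open>y\<close> asks only for the fresh sites
  \<open>anc y - anc x\<close>, and these are independent of \<open>past x\<close>.\<close>

lemma bern_mean_cond_superset:
  assumes xy: "x \<in> A" "y \<in> A" "le x y"
    and f: "\<And>r. \<not> anc x \<subseteq> r \<Longrightarrow> f r = 0"
  shows "bern_mean p C (\<lambda>r. of_bool (anc y \<subseteq> r) * bern_cond p C (past x) f r)
    = p ^ card (anc y - anc x) * bern_mean p C f"
proof -
  let ?b = "bern_cond p C (past x) f" and ?D = "anc y - anc x"
  have b0: "?b r = 0" if "\<not> anc x \<subseteq> r" for r
  proof -
    have "f (r \<inter> past x \<union> t) = 0" if "t \<subseteq> C - past x" for t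
      using anc_sub_past[OF xy(1)] \<open>\<not> anc x \<subseteq> r\<close> that by (intro f) blast
    then have "?b r = bern_mean p (C - past x) (\<lambda>_. 0)"
      unfolding bern_cond_def by (intro bern_mean_cong) auto
    then show ?thesis by (simp add: bern_mean_def)
  qed
  have "bern_mean p C (\<lambda>r. of_bool (anc y \<subseteq> r) * ?b r) = bern_mean p C (\<lambda>r. of_bool (?D \<subseteq> r) * ?b r)"
  proof (intro bern_mean_cong)
    fix r show "of_bool (anc y \<subseteq> r) * ?b r = of_bool (?D \<subseteq> r) * ?b r"
      using b0[of r] by (cases "anc x \<subseteq> r") (auto intro!: arg_cong[where f = of_bool])
  qed
  also have "\<dots> = p ^ card ?D * bern_mean p C ?b"
  proof (intro bern_mean_superset_mult finite_C)
    show "?D \<subseteq> C" using anc_sub[OF xy(2)] by auto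
    fix r
    have "(r - ?D) \<inter> past x = r \<inter> past x" using anc_Diff_past[OF xy] by auto
    then show "?b r = ?b (r - ?D)" by (simp add: bern_cond_def)
  qed
  also have "bern_mean p C ?b = bern_mean p C f"
    using bern_mean_cond_mult[OF finite_C past_sub[of x], of "\<lambda>_. 1" p f] by simp
  finally show ?thesis .
qed

text \<open>Both sides are compared with \<open>2 * t\<close> times the percolation mean of
  \<open>Z * B\<close>, where \<open>Z\<close> is the weighted count of surviving points and
  \<open>B\<close> the sum of the projections: the left through the pairs with
  \<open>le x y\<close>, the right through \<open>2 * (z * u) \<le> z^2 + u^2\<close> and
  \<open>dual_doob\<close>. In the application the path is fixed, \<open>v\<close> carries the
  visits and \<open>f x\<close> indicates that \<open>x\<close> is hit first; \<open>t\<close> stays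
  free because it has to be the same for all paths.\<close>

lemma first_point_energy_le:
  fixes v :: "'x \<Rightarrow> ennreal" and t :: ennreal
  assumes f_nonneg: "\<And>x r. 0 \<le> f x r" and f0: "\<And>x r. \<not> anc x \<subseteq> r \<Longrightarrow> f x r = 0"
  shows "2 * t * (\<Sum>x\<in>A. \<Sum>y\<in>A. if le x y
        then v y * ennreal (p ^ card (anc y - anc x) * bern_mean p C (f x)) else 0)
    \<le> (\<Sum>r\<in>Pow C. ennreal (bern_weight p C r) * (\<Sum>y\<in>A. v y * of_bool (anc y \<subseteq> r))^2)
      + t^2 * ennreal (4 * bern_mean p C (\<lambda>r. (\<Sum>x\<in>A. f x r)^2))"
proof -
  define b where "b x = bern_cond p C (past x) (f x)" for x
  define B where "B r = (\<Sum>x\<in>A. b x r)" for r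
  define Z where "Z r = (\<Sum>y\<in>A. v y * of_bool (anc y \<subseteq> r))" for r
  let ?w = "\<lambda>r. ennreal (bern_weight p C r)"
  have b0: "0 \<le> b x r" for x r unfolding b_def using p f_nonneg by (intro bern_cond_nonneg)
  have w0: "0 \<le> bern_weight p C r" for r using p by (intro bern_weight_nonneg)
  have enn_mean: "(\<Sum>r\<in>Pow C. ?w r * ennreal (h r)) = ennreal (bern_mean p C h)"
    if "\<And>r. 0 \<le> h r" for h
    unfolding bern_mean_def using that w0
    by (subst sum_ennreal[symmetric]) (auto simp: ennreal_mult)
  have ZB: "(\<Sum>r\<in>Pow C. ?w r * (Z r * ennreal (B r))) =
      (\<Sum>x\<in>A. \<Sum>y\<in>A. v y * ennreal (bern_mean p C (\<lambda>r. of_bool (anc y \<subseteq> r) * b x r)))"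
  proof -
    have "?w r * (Z r * ennreal (B r)) =
        (\<Sum>x\<in>A. \<Sum>y\<in>A. v y * (?w r * ennreal (of_bool (anc y \<subseteq> r) * b x r)))" for r
      unfolding Z_def B_def
      by (subst sum_ennreal[symmetric], use b0 in simp, subst sum_product, subst sum.swap)
        (auto simp: sum_distrib_left mult_ac intro!: sum.cong)
    then have "(\<Sum>r\<in>Pow C. ?w r * (Z r * ennreal (B r))) =
        (\<Sum>r\<in>Pow C. \<Sum>x\<in>A. \<Sum>y\<in>A. v y * (?w r * ennreal (of_bool (anc y \<subseteq> r) * b x r)))"
      by simp
    also have "\<dots> = (\<Sum>x\<in>A. \<Sum>y\<in>A. \<Sum>r\<in>Pow C. v y * (?w r * ennreal (of_bool (anc y \<subseteq> r) * b x r)))"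
      by (subst sum.swap, intro sum.cong refl, rule sum.swap)
    also have "\<dots> = (\<Sum>x\<in>A. \<Sum>y\<in>A. v y * ennreal (bern_mean p C (\<lambda>r. of_bool (anc y \<subseteq> r) * b x r)))"
      by (subst enn_mean[symmetric]) (use b0 in \<open>auto simp: sum_distrib_left\<close>)
    finally show ?thesis .
  qed
  \<comment> \<open>Pairs violating \<open>le x y\<close> are dropped; on the others the terms
    agree.\<close>
  have "(\<Sum>x\<in>A. \<Sum>y\<in>A. if le x y
        then v y * ennreal (p ^ card (anc y - anc x) * bern_mean p C (f x)) else 0)
      \<le> (\<Sum>x\<in>A. \<Sum>y\<in>A. v y * ennreal (bern_mean p C (\<lambda>r. of_bool (anc y \<subseteq> r) * b x r)))"
    unfolding b_def using f0 by (intro sum_mono) (auto simp: bern_mean_cond_superset)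
  then have "2 * t * (\<Sum>x\<in>A. \<Sum>y\<in>A. if le x y
        then v y * ennreal (p ^ card (anc y - anc x) * bern_mean p C (f x)) else 0)
      \<le> 2 * t * (\<Sum>r\<in>Pow C. ?w r * (Z r * ennreal (B r)))"
    unfolding ZB by (intro mult_left_mono) auto
  also have "\<dots> = (\<Sum>r\<in>Pow C. ?w r * (2 * (Z r * (t * ennreal (B r)))))"
    by (simp add: sum_distrib_left mult_ac)
  also have "\<dots> \<le> (\<Sum>r\<in>Pow C. ?w r * ((Z r)^2 + (t * ennreal (B r))^2))"
    by (intro sum_mono mult_left_mono ennreal_two_mult_le_squares) auto
  also have "\<dots> = (\<Sum>r\<in>Pow C. ?w r * (Z r)^2) + t^2 * (\<Sum>r\<in>Pow C. ?w r * ennreal ((B r)^2))"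
  proof -
    have "0 \<le> B r" for r unfolding B_def using b0 by (intro sum_nonneg)
    then show ?thesis
      by (simp add: distrib_left sum.distrib sum_distrib_left power_mult_distrib ennreal_power mult_ac)
  qed
  also have "(\<Sum>r\<in>Pow C. ?w r * ennreal ((B r)^2)) = ennreal (bern_mean p C (\<lambda>r. (B r)^2))"
    by (intro enn_mean) auto
  also have "\<dots> \<le> ennreal (4 * bern_mean p C (\<lambda>r. (\<Sum>x\<in>A. f x r)^2))"
    unfolding B_def b_def using f_nonneg by (intro ennreal_leI dual_doob)
  finally show ?thesis by (simp add: Z_def add_left_mono mult_left_mono)
qed

end

section \<open>Occupation times of a Markov chain\<close>

text \<open>Every pair of times is ordered one way or the other, and the diagonal is counted twice.
  This splits products of visit counts by which visit comes first, the form in which the Markov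
  property applies.\<close>

lemma suminf_split_diagonal_ennreal:
  fixes u :: "nat \<Rightarrow> nat \<Rightarrow> ennreal"
  shows "(\<Sum>n. \<Sum>m. u n m) \<le> (\<Sum>n. \<Sum>m. u n (n + m)) + (\<Sum>m. \<Sum>n. u (m + n) m)"
proof -
  have tail: "(\<Sum>m. of_bool (n \<le> m) * f m) \<le> (\<Sum>m. f (n + m))" for n and f :: "nat \<Rightarrow> ennreal"
  proof -
    have "(\<Sum>m. of_bool (n \<le> m) * f m) =
        (\<Sum>m. of_bool (n \<le> m + n) * f (m + n)) + (\<Sum>m<n. of_bool (n \<le> m) * f m)"
      by (intro suminf_offset) simp
    then show ?thesis by (simp add: add.commute)
  qed
  have "(\<Sum>n. \<Sum>m. u n m) \<le> (\<Sum>n. (\<Sum>m. of_bool (n \<le> m) * u n m) + (\<Sum>m. of_bool (m \<le> n) * u n m))"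
    by (subst suminf_add; (rule suminf_le summableI)+; auto simp: not_le_imp_less less_imp_le)
  also have "\<dots> = (\<Sum>n. \<Sum>m. of_bool (n \<le> m) * u n m) + (\<Sum>n. \<Sum>m. of_bool (m \<le> n) * u n m)"
    by (intro suminf_add[symmetric]) auto
  \<comment> \<open>Tonelli, with one of the sums read as an integral against counting
    measure.\<close>
  also have "(\<Sum>n. \<Sum>m. of_bool (m \<le> n) * u n m) = (\<Sum>m. \<Sum>n. of_bool (m \<le> n) * u n m)"
    using nn_integral_suminf[of "\<lambda>m n. of_bool (m \<le> n) * u n m" "count_space UNIV"]
    by (simp add: nn_integral_count_space_nat)
  also have "(\<Sum>n. \<Sum>m. of_bool (n \<le> m) * u n m) \<le> (\<Sum>n. \<Sum>m. u n (n + m))"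
    by (intro suminf_le tail) auto
  also have "(\<Sum>m. \<Sum>n. of_bool (m \<le> n) * u n m) \<le> (\<Sum>m. \<Sum>n. u (m + n) m)"
    by (intro suminf_le tail) auto
  finally show ?thesis by (simp add: add_left_mono add_right_mono)
qed

locale markov_chain = prob_space M
  for M :: "'w measure" +
  fixes X :: "nat \<Rightarrow> 'w \<Rightarrow> 's :: countable" and K :: "'s \<Rightarrow> 's pmf" and a :: 's
  assumes X_measurable [measurable]: "\<And>n. X n \<in> measurable M (count_space UNIV)"
    and X_start: "AE w in M. X 0 w = a"
    and markov: "\<And>n xs y. measure M {w\<in>space M. (\<forall>i\<le>n. X i w = xs i) \<and> X (Suc n) w = y}
      = measure M {w\<in>space M. \<forall>i\<le>n. X i w = xs i} * pmf (K (xs n)) y"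
begin

text \<open>The positions at times \<open>0\<close> to \<open>n - 1\<close>, so the history up to
  and including time \<open>n\<close> is \<open>path (Suc n)\<close>. Lists over a countable type
  are countable, so every event about the history splits into countably many atoms.\<close>

definition path :: "nat \<Rightarrow> 'w \<Rightarrow> 's list" where
  "path n w = map (\<lambda>i. X i w) [0..<n]"

lemma path_nth: "i < n \<Longrightarrow> path n w ! i = X i w"
  unfolding path_def by (subst nth_map) (auto simp del: upt_Suc)

lemma path_eq_iff: "path n w = l \<longleftrightarrow> length l = n \<and> (\<forall>i<n. X i w = l ! i)"
  unfolding path_def by (subst list_eq_iff_nth_eq) auto

lemma path_measurable [measurable]: "path n \<in> measurable M (count_space UNIV)"
proof (subst measurable_count_space_eq_countable)
  show "path n \<in> space M \<rightarrow> UNIV \<and> (\<forall>l\<in>UNIV. path n -` {l} \<inter> space M \<in> sets M)"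
  proof (intro conjI ballI)
    fix l :: "'s list"
    have "path n -` {l} \<inter> space M = {w\<in>space M. length l = n \<and> (\<forall>i<n. X i w = l ! i)}"
      using path_eq_iff[of n _ l] by auto
    also have "\<dots> \<in> sets M" by measurable
    finally show "path n -` {l} \<inter> space M \<in> sets M" .
  qed auto
qed auto

lemma emeasure_partition:
  fixes Y :: "'w \<Rightarrow> 'b :: countable"
  assumes [measurable]: "Y \<in> measurable M (count_space UNIV)" "Measurable.pred M Q"
  shows "emeasure M {w\<in>space M. Q w} = (\<integral>\<^sup>+l. emeasure M {w\<in>space M. Q w \<and> Y w = l} \<partial>count_space UNIV)"
proof -
  have "{w\<in>space M. Q w} = (\<Union>l\<in>UNIV. {w\<in>space M. Q w \<and> Y w = l})" by auto
  also have "emeasure M \<dots> = (\<integral>\<^sup>+l. emeasure M {w\<in>space M. Q w \<and> Y w = l} \<partial>count_space UNIV)"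
    by (intro emeasure_UN_countable) (auto simp: disjoint_family_on_def)
  finally show ?thesis .
qed

text \<open>The assumption \<open>markov\<close> treats one history at a time; summing over the
  values of \<open>path (Suc n)\<close> extends it to any event \<open>Q\<close> of the
  history.\<close>

lemma emeasure_path_Suc:
  "emeasure M {w\<in>space M. Q (path (Suc n) w) \<and> X n w = x \<and> X (Suc n) w = y}
    = emeasure M {w\<in>space M. Q (path (Suc n) w) \<and> X n w = x} * ennreal (pmf (K x) y)"
proof -
  have nth: "path (Suc n) w ! n = X n w" for w
    by (simp add: path_nth)
  have cyl: "emeasure M {w\<in>space M. (Q (path (Suc n) w) \<and> X n w = x \<and> X (Suc n) w = y) \<and> path (Suc n) w = l}
      = emeasure M {w\<in>space M. (Q (path (Suc n) w) \<and> X n w = x) \<and> path (Suc n) w = l} * ennreal (pmf (K x) y)" for l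
  proof (cases "Q l \<and> length l = Suc n \<and> l ! n = x")
    case True
    then have eq: "path (Suc n) w = l \<longleftrightarrow> (\<forall>i\<le>n. X i w = l ! i)" for w
      by (simp add: path_eq_iff less_Suc_eq_le)
    have "{w\<in>space M. (Q (path (Suc n) w) \<and> X n w = x \<and> X (Suc n) w = y) \<and> path (Suc n) w = l}
        = {w\<in>space M. (\<forall>i\<le>n. X i w = l ! i) \<and> X (Suc n) w = y}"
      using True nth by (auto simp: eq[symmetric])
    moreover have "{w\<in>space M. (Q (path (Suc n) w) \<and> X n w = x) \<and> path (Suc n) w = l}
        = {w\<in>space M. \<forall>i\<le>n. X i w = l ! i}"
      using True nth by (auto simp: eq[symmetric])
    ultimately show ?thesis
      using markov[of n "\<lambda>i. l ! i" y] True
      by (simp add: emeasure_eq_measure ennreal_mult)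
  next
    case False
    have "length (path (Suc n) w) = Suc n" for w by (simp add: path_def)
    with False nth have
      "{w\<in>space M. (Q (path (Suc n) w) \<and> X n w = x) \<and> path (Suc n) w = l} = {}"
      "{w\<in>space M. (Q (path (Suc n) w) \<and> X n w = x \<and> X (Suc n) w = y) \<and> path (Suc n) w = l} = {}"
      by auto
    then show ?thesis by (simp only: emeasure_empty mult_zero_left)
  qed
  let ?c = "count_space (UNIV :: 's list set)"
  have "emeasure M {w\<in>space M. Q (path (Suc n) w) \<and> X n w = x \<and> X (Suc n) w = y}
      = (\<integral>\<^sup>+l. emeasure M {w\<in>space M. (Q (path (Suc n) w) \<and> X n w = x \<and> X (Suc n) w = y) \<and> path (Suc n) w = l} \<partial>?c)"
    by (intro emeasure_partition) measurable
  also have "\<dots> = (\<integral>\<^sup>+l. emeasure M {w\<in>space M. (Q (path (Suc n) w) \<and> X n w = x) \<and> path (Suc n) w = l} * ennreal (pmf (K x) y) \<partial>?c)"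
    by (intro nn_integral_cong cyl)
  also have "\<dots> = (\<integral>\<^sup>+l. emeasure M {w\<in>space M. (Q (path (Suc n) w) \<and> X n w = x) \<and> path (Suc n) w = l} \<partial>?c) * ennreal (pmf (K x) y)"
    by (intro nn_integral_multc) auto
  also have "(\<integral>\<^sup>+l. emeasure M {w\<in>space M. (Q (path (Suc n) w) \<and> X n w = x) \<and> path (Suc n) w = l} \<partial>?c)
      = emeasure M {w\<in>space M. Q (path (Suc n) w) \<and> X n w = x}"
    by (intro emeasure_partition[symmetric]) measurable
  finally show ?thesis .
qed

text \<open>Induction on \<open>m\<close>, splitting by the position at time
  \<open>n + m\<close>.\<close>

lemma emeasure_path_kstep:
  "emeasure M {w\<in>space M. Q (path (Suc n) w) \<and> X n w = x \<and> X (n + m) w = y}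
    = emeasure M {w\<in>space M. Q (path (Suc n) w) \<and> X n w = x} * ennreal (pmf (kstep K m x) y)"
proof (induction m arbitrary: y)
  case 0
  show ?case
  proof (cases "x = y")
    case True
    then have "{w\<in>space M. Q (path (Suc n) w) \<and> X n w = x \<and> X (n + 0) w = y}
        = {w\<in>space M. Q (path (Suc n) w) \<and> X n w = x}" by auto
    with True show ?thesis by simp
  next
    case False
    then have "{w\<in>space M. Q (path (Suc n) w) \<and> X n w = x \<and> X (n + 0) w = y} = {}" by auto
    with False show ?thesis by (simp only: emeasure_empty) (simp add: pmf_return)
  qed
next
  case (Suc m)
  let ?E = "emeasure M {w\<in>space M. Q (path (Suc n) w) \<and> X n w = x}"
  \<comment> \<open>An event of the history up to time \<open>n\<close> is also one of the longer
    history up to \<open>n + m\<close>, so the one-step lemma applies at that time.\<close>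
  have path_take: "path (Suc n) w = take (Suc n) (path (Suc (n + m)) w)"
    "X n w = path (Suc (n + m)) w ! n" for w
    by (simp_all add: path_nth) (simp add: path_def take_map take_upt del: upt_Suc)
  have "emeasure M {w\<in>space M. Q (path (Suc n) w) \<and> X n w = x \<and> X (n + Suc m) w = y}
      = (\<integral>\<^sup>+z. emeasure M {w\<in>space M. (Q (path (Suc n) w) \<and> X n w = x \<and> X (n + Suc m) w = y) \<and> X (n + m) w = z} \<partial>count_space UNIV)"
    by (intro emeasure_partition) auto
  also have "\<dots> = (\<integral>\<^sup>+z. emeasure M {w\<in>space M. Q (path (Suc n) w) \<and> X n w = x \<and> X (n + m) w = z} * ennreal (pmf (K z) y) \<partial>count_space UNIV)"
  proof (intro nn_integral_cong)
    fix z
    show "emeasure M {w\<in>space M. (Q (path (Suc n) w) \<and> X n w = x \<and> X (n + Suc m) w = y) \<and> X (n + m) w = z}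
      = emeasure M {w\<in>space M. Q (path (Suc n) w) \<and> X n w = x \<and> X (n + m) w = z} * ennreal (pmf (K z) y)"
      using emeasure_path_Suc[of "\<lambda>l. Q (take (Suc n) l) \<and> l ! n = x" "n + m" z y]
      by (simp add: path_take[symmetric] conj_ac)
  qed
  also have "\<dots> = (\<integral>\<^sup>+z. ?E * (ennreal (pmf (kstep K m x) z) * ennreal (pmf (K z) y)) \<partial>count_space UNIV)"
    by (simp add: Suc.IH mult.assoc)
  also have "\<dots> = ?E * ennreal (pmf (kstep K (Suc m) x) y)"
    by (simp add: nn_integral_cmult ennreal_pmf_bind nn_integral_measure_pmf)
  finally show ?case .
qed

lemma emeasure_X: "emeasure M {w\<in>space M. X n w = y} = ennreal (pmf (kstep K n a) y)"
proof -
  have "emeasure M {w\<in>space M. X n w = y} = emeasure M {w\<in>space M. X 0 w = a \<and> X n w = y}"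
    using X_start by (intro emeasure_eq_AE) auto
  also have "\<dots> = emeasure M {w\<in>space M. X 0 w = a} * ennreal (pmf (kstep K n a) y)"
    using emeasure_path_kstep[of "\<lambda>_. True" 0 a n y] by simp
  also have "emeasure M {w\<in>space M. X 0 w = a} = emeasure M (space M)"
    using X_start by (intro emeasure_eq_AE) auto
  finally show ?thesis by (simp add: emeasure_space_1)
qed

section \<open>Visit counts and the Green function\<close>

definition visits :: "'s \<Rightarrow> 'w \<Rightarrow> ennreal" where
  "visits y w = (\<Sum>n. of_bool (X n w = y))"

lemma visits_measurable [measurable]: "visits y \<in> borel_measurable M"
  unfolding visits_def of_bool_def by measurable

lemma nn_integral_of_bool:
  assumes "Measurable.pred M Q"
  shows "(\<integral>\<^sup>+w. of_bool (Q w) \<partial>M) = emeasure M {w\<in>space M. Q w}"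
proof -
  have "(\<integral>\<^sup>+w. of_bool (Q w) \<partial>M) = (\<integral>\<^sup>+w. indicator {w\<in>space M. Q w} w \<partial>M)"
    by (intro nn_integral_cong) (auto simp: indicator_def)
  then show ?thesis using assms by simp
qed

lemma nn_integral_visits: "(\<integral>\<^sup>+w. visits y w \<partial>M) = green K a y"
proof -
  have "(\<integral>\<^sup>+w. visits y w \<partial>M) = (\<Sum>n. \<integral>\<^sup>+w. of_bool (X n w = y) \<partial>M)"
    unfolding visits_def of_bool_def by (intro nn_integral_suminf) measurable
  then show ?thesis by (simp add: nn_integral_of_bool emeasure_X green_def)
qed

text \<open>The Markov property at the fixed time \<open>n\<close>: whatever the past, a chain at
  \<open>x\<close> makes \<open>green K x y\<close> visits to \<open>y\<close> on average from then
  on, time \<open>n\<close> included.\<close>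

lemma nn_integral_path_visits_after:
  "(\<integral>\<^sup>+w. (\<Sum>m. of_bool (Q (path (Suc n) w) \<and> X n w = x \<and> X (n + m) w = y)) \<partial>M)
    = emeasure M {w\<in>space M. Q (path (Suc n) w) \<and> X n w = x} * green K x y"
proof -
  have "(\<integral>\<^sup>+w. (\<Sum>m. of_bool (Q (path (Suc n) w) \<and> X n w = x \<and> X (n + m) w = y)) \<partial>M)
      = (\<Sum>m. \<integral>\<^sup>+w. of_bool (Q (path (Suc n) w) \<and> X n w = x \<and> X (n + m) w = y) \<partial>M)"
    unfolding of_bool_def by (intro nn_integral_suminf) measurable
  also have "\<dots> = (\<Sum>m. emeasure M {w\<in>space M. Q (path (Suc n) w) \<and> X n w = x} * ennreal (pmf (kstep K m x) y))"
    by (simp add: nn_integral_of_bool emeasure_path_kstep)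
  finally show ?thesis by (simp add: green_def)
qed

lemma nn_integral_visits_after:
  "(\<integral>\<^sup>+w. (\<Sum>n m. of_bool (X n w = x \<and> X (n + m) w = y)) \<partial>M) = green K a x * green K x y"
proof -
  have "(\<integral>\<^sup>+w. (\<Sum>n m. of_bool (X n w = x \<and> X (n + m) w = y)) \<partial>M)
      = (\<Sum>n. \<integral>\<^sup>+w. (\<Sum>m. of_bool (X n w = x \<and> X (n + m) w = y)) \<partial>M)"
    unfolding of_bool_def by (intro nn_integral_suminf) measurable
  also have "\<dots> = (\<Sum>n. ennreal (pmf (kstep K n a) x) * green K x y)"
    using nn_integral_path_visits_after[of "\<lambda>_. True"] by (simp add: emeasure_X)
  finally show ?thesis by (simp add: green_def)
qed

text \<open>Pairs of visit times are split by which comes first; restarting at the earlier visit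
  contributes the second Green function.\<close>

lemma nn_integral_visits_mult_le:
  "(\<integral>\<^sup>+w. visits x w * visits y w \<partial>M) \<le> green K a x * green K x y + green K a y * green K y x"
proof -
  have "visits x w * visits y w
      \<le> (\<Sum>n m. of_bool (X n w = x \<and> X (n + m) w = y)) + (\<Sum>n m. of_bool (X n w = y \<and> X (n + m) w = x))"
    for w
  proof -
    have "visits x w * visits y w = (\<Sum>n m. of_bool (X n w = x) * of_bool (X m w = y))"
      by (simp add: visits_def)
    then show ?thesis
      using suminf_split_diagonal_ennreal[of "\<lambda>n m. of_bool (X n w = x) * of_bool (X m w = y)"]
      by (simp add: of_bool_conj mult.commute)
  qed
  then have "(\<integral>\<^sup>+w. visits x w * visits y w \<partial>M) \<le> (\<integral>\<^sup>+w. (\<Sum>n m. of_bool (X n w = x \<and> X (n + m) w = y)) + (\<Sum>n m. of_bool (X n w = y \<and> X (n + m) w = x)) \<partial>M)"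
    by (intro nn_integral_mono)
  also have "\<dots> = (\<integral>\<^sup>+w. (\<Sum>n m. of_bool (X n w = x \<and> X (n + m) w = y)) \<partial>M) + (\<integral>\<^sup>+w. (\<Sum>n m. of_bool (X n w = y \<and> X (n + m) w = x)) \<partial>M)"
    unfolding of_bool_def by (intro nn_integral_add) measurable
  finally show ?thesis by (simp add: nn_integral_visits_after)
qed

section \<open>First entrance into a set and the strong Markov property\<close>

definition first_hit :: "'s set \<Rightarrow> 's \<Rightarrow> 'w \<Rightarrow> bool" where
  "first_hit A x w \<longleftrightarrow> x \<in> A \<and> (\<exists>n. X n w = x \<and> (\<forall>i<n. X i w \<notin> A))"

lemma first_hit_measurable [measurable]: "Measurable.pred M (first_hit A x)"
  unfolding first_hit_def by measurable

lemma first_hit_unique: "first_hit A x w \<Longrightarrow> first_hit A y w \<Longrightarrow> x = y"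
  unfolding first_hit_def by (metis linorder_neqE_nat)

lemma hit_iff_first_hit: "(\<exists>n. X n w \<in> A) \<longleftrightarrow> (\<exists>x\<in>A. first_hit A x w)"
proof
  assume "\<exists>n. X n w \<in> A"
  then show "\<exists>x\<in>A. first_hit A x w"
    unfolding first_hit_def using exists_least_iff[of "\<lambda>n. X n w \<in> A"] by blast
qed (auto simp: first_hit_def)

text \<open>The first hitting events are disjoint for different points and exhaust the event of a
  hit. The type of the values is left open because both real and \<open>ennreal\<close> indicators
  are summed later.\<close>

lemma sum_first_hit:
  assumes "finite B" "A \<subseteq> B"
  shows "(\<Sum>x\<in>B. of_bool (first_hit A x w)) = (of_bool (\<exists>n. X n w \<in> A) :: 'b :: semiring_1)"
proof (cases "\<exists>n. X n w \<in> A")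
  case True
  then obtain x where x: "x \<in> A" "first_hit A x w" by (auto simp: hit_iff_first_hit)
  then have "(\<Sum>x\<in>B. of_bool (first_hit A x w)) = (\<Sum>x\<in>{x}. of_bool (first_hit A x w) :: 'b)"
    using assms by (intro sum.mono_neutral_right) (auto dest: first_hit_unique)
  with x True show ?thesis by simp
next
  case False
  then have "\<not> first_hit A x w" for x by (auto simp: first_hit_def)
  with False show ?thesis by simp
qed

text \<open>The strong Markov property at the first entrance into \<open>A\<close>, obtained by
  summing over its time. It is an inequality because visits to \<open>y\<close> before the entrance
  are discarded.\<close>

lemma nn_integral_visits_first_hit_ge:
  "emeasure M {w\<in>space M. first_hit A x w} * green K x y
    \<le> (\<integral>\<^sup>+w. visits y w * of_bool (first_hit A x w) \<partial>M)"
proof (cases "x \<in> A")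
  case True
  define H where "H n w \<longleftrightarrow> X n w = x \<and> (\<forall>i<n. X i w \<notin> A)" for n w
  \<comment> \<open>\<open>H n\<close> says that the first entrance happens at time \<open>n\<close>
    and at \<open>x\<close>. It depends only on the history up to \<open>n\<close> and holds for at
    most one \<open>n\<close>.\<close>
  have [measurable]: "Measurable.pred M (H n)" for n unfolding H_def by measurable
  have H_unique: "H n w \<Longrightarrow> H m w \<Longrightarrow> n = m" for n m w
    unfolding H_def using True by (metis linorder_neqE_nat)
  have first_hit_H: "first_hit A x w \<longleftrightarrow> (\<exists>n. H n w)" for w
    using True by (auto simp: first_hit_def H_def)
  have sum_H: "(\<Sum>n. of_bool (H n w) * f n) = f k" if "H k w"
    for w k and f :: "nat \<Rightarrow> ennreal"
  proof -
    have "\<not> H n w" if "n \<notin> {k}" for n using H_unique[of n w k] \<open>H k w\<close> that by auto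
    then have "(\<Sum>n. of_bool (H n w) * f n) = (\<Sum>n\<in>{k}. of_bool (H n w) * f n)"
      by (intro suminf_finite) auto
    with that show ?thesis by simp
  qed
  have H_path: "H n w \<longleftrightarrow> (\<forall>i<n. path (Suc n) w ! i \<notin> A) \<and> X n w = x" for n w
    by (auto simp: H_def path_nth)
  have "{w\<in>space M. first_hit A x w} = (\<Union>n. {w\<in>space M. H n w})"
    by (auto simp: first_hit_H)
  then have "emeasure M {w\<in>space M. first_hit A x w} = (\<Sum>n. emeasure M {w\<in>space M. H n w})"
    by (simp, intro suminf_emeasure[symmetric]) (auto simp: disjoint_family_on_def dest: H_unique)
  then have "emeasure M {w\<in>space M. first_hit A x w} * green K x y
      = (\<Sum>n. emeasure M {w\<in>space M. H n w} * green K x y)"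
    by simp
  also have "\<dots> = (\<Sum>n. \<integral>\<^sup>+w. (\<Sum>m. of_bool (H n w \<and> X (n + m) w = y)) \<partial>M)"
    using nn_integral_path_visits_after[of "\<lambda>l. \<forall>i<n. l ! i \<notin> A" n x y for n]
    by (simp add: H_path conj_ac)
  also have "\<dots> = (\<integral>\<^sup>+w. (\<Sum>n m. of_bool (H n w \<and> X (n + m) w = y)) \<partial>M)"
    unfolding of_bool_def by (intro nn_integral_suminf[symmetric]) measurable
  also have "\<dots> \<le> (\<integral>\<^sup>+w. visits y w * of_bool (first_hit A x w) \<partial>M)"
  proof (intro nn_integral_mono)
    fix w
    have "(\<Sum>n m. of_bool (H n w \<and> X (n + m) w = y)) = (\<Sum>n. of_bool (H n w) * (\<Sum>m. of_bool (X (n + m) w = y)) :: ennreal)"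
      by (simp add: of_bool_conj)
    also have "\<dots> \<le> visits y w * of_bool (first_hit A x w)"
    proof (cases "first_hit A x w")
      case True
      then obtain k where k: "H k w" by (auto simp: first_hit_H)
      have "visits y w = (\<Sum>m. of_bool (X (m + k) w = y)) + (\<Sum>m<k. of_bool (X m w = y))"
        unfolding visits_def by (intro suminf_offset) simp
      then have "(\<Sum>m. of_bool (X (k + m) w = y)) \<le> visits y w" by (simp add: add.commute)
      then show ?thesis using True k by (simp add: sum_H[OF k])
    next
      case False
      then have "\<not> H n w" for n by (auto simp: first_hit_H)
      with False show ?thesis by simp
    qed
    finally show "(\<Sum>n m. of_bool (H n w \<and> X (n + m) w = y)) \<le> visits y w * of_bool (first_hit A x w)" .
  qed
  finally show ?thesis .
qed (simp add: first_hit_def)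

end

section \<open>A Markov chain among surviving points\<close>

text \<open>The geometry is forgotten: each point carries a finite set \<open>anc x\<close> of sites
  that must all be retained. The percolation is averaged by finite sums over configurations
  \<open>r\<close>, so that integrals over \<open>M\<close> concern the chain alone.\<close>

locale percolated_chain = markov_chain M X K a
  for M :: "'w measure" and X :: "nat \<Rightarrow> 'w \<Rightarrow> 's :: countable" and K :: "'s \<Rightarrow> 's pmf" and a :: 's +
  fixes p :: real and anc :: "'s \<Rightarrow> 'c set" and A :: "'s set"
  assumes p_pos: "0 < p" and p_le_1: "p \<le> 1"
    and finite_A: "finite A" and finite_anc: "\<And>x. finite (anc x)"
    and transient: "\<And>x y. green K x y \<noteq> \<top>"
begin

abbreviation sites :: "'c set" where "sites \<equiv> \<Union>(anc ` A)"

definition surv :: "'c set \<Rightarrow> 's set" where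
  "surv r = {x\<in>A. anc x \<subseteq> r}"

definition wt :: "'c set \<Rightarrow> ennreal" where
  "wt r = ennreal (bern_weight p sites r)"

definition hit_prob :: ennreal where
  "hit_prob = (\<Sum>r\<in>Pow sites. wt r * emeasure M {w\<in>space M. \<exists>n. X n w \<in> surv r})"

text \<open>One kernel serves both energies: with dyadic cubes as sites, points in different shells
  share no site and the power of \<open>p\<close> is then 1.\<close>

definition kernel :: "'s \<Rightarrow> 's \<Rightarrow> ennreal" where
  "kernel x y = green K x y / green K a y * ennreal (1 / p ^ card (anc x \<inter> anc y))"

definition energy :: "('s \<Rightarrow> real) \<Rightarrow> ennreal" where
  "energy m = (\<Sum>x\<in>A. \<Sum>y\<in>A. kernel x y * ennreal (m x) * ennreal (m y))"

text \<open>The denominator is the mean number of visits to \<open>y\<close> counted on survival of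
  \<open>y\<close>. So \<open>mass m\<close> has the total mass of \<open>m\<close> as its mean
  whenever \<open>m\<close> charges only points with nonzero Green function from
  \<open>a\<close>.\<close>

definition coef :: "('s \<Rightarrow> real) \<Rightarrow> 's \<Rightarrow> ennreal" where
  "coef m y = ennreal (m y) / (green K a y * ennreal (p ^ card (anc y)))"

definition mass :: "('s \<Rightarrow> real) \<Rightarrow> 'c set \<Rightarrow> 'w \<Rightarrow> ennreal" where
  "mass m r w = (\<Sum>y\<in>A. visits y w * coef m y * of_bool (anc y \<subseteq> r))"

lemma finite_sites: "finite sites"
  using finite_A finite_anc by auto

lemma mass_measurable [measurable]: "mass m r \<in> borel_measurable M"
  unfolding mass_def by measurable

lemma sum_wt_mean:
  assumes "\<And>r. 0 \<le> h r"
  shows "(\<Sum>r\<in>Pow sites. wt r * ennreal (h r)) = ennreal (bern_mean p sites h)"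
  unfolding bern_mean_def wt_def using assms p_pos p_le_1
  by (subst sum_ennreal[symmetric]) (auto simp: ennreal_mult bern_weight_nonneg)

lemma sum_wt_superset:
  assumes "D \<subseteq> sites"
  shows "(\<Sum>r\<in>Pow sites. wt r * of_bool (D \<subseteq> r)) = ennreal (p ^ card D)"
proof -
  have "(\<Sum>r\<in>Pow sites. wt r * ennreal (of_bool (D \<subseteq> r))) = ennreal (p ^ card D)"
    using bern_mean_superset[OF finite_sites assms] by (subst sum_wt_mean) auto
  moreover have "ennreal (of_bool b) = of_bool b" for b by (cases b) auto
  ultimately show ?thesis by simp
qed

lemma coef_mult_green:
  assumes "0 \<le> m y" "m y \<noteq> 0 \<Longrightarrow> green K a y \<noteq> 0"
  shows "coef m y * green K a y * ennreal (p ^ card (anc y)) = ennreal (m y)"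
proof (cases "m y = 0")
  case False
  then have "green K a y * ennreal (p ^ card (anc y)) \<noteq> 0" "green K a y * ennreal (p ^ card (anc y)) \<noteq> \<top>"
    using assms p_pos transient by (auto simp: ennreal_mult_eq_top_iff)
  then show ?thesis
    unfolding coef_def mult.assoc
    by (simp only: ennreal_divide_times ennreal_divide_self less_top mult_1_right not_False_eq_True)
qed (simp add: coef_def)

text \<open>The sites of \<open>y\<close> are those shared with \<open>x\<close> and the fresh ones.
  Cancelling the fresh ones against \<open>coef\<close> leaves the shared ones in the denominator,
  as in \<open>kernel\<close>.\<close>

lemma kernel_mult_coef:
  assumes "0 \<le> m y" "m y \<noteq> 0 \<Longrightarrow> green K a y \<noteq> 0"
  shows "green K x y * coef m y * ennreal (p ^ card (anc y - anc x)) = kernel x y * ennreal (m y)"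
proof (cases "m y = 0")
  case False
  obtain g where g: "green K x y = ennreal g" "0 \<le> g" using transient[of x y] by (cases "green K x y") auto
  obtain h where h: "green K a y = ennreal h" "0 \<le> h" using transient[of a y] by (cases "green K a y") auto
  have h0: "0 < h" using assms(2)[OF False] h by auto
  have "card (anc y) = card (anc y - anc x) + card (anc x \<inter> anc y)"
    using card_Diff_subset_Int[of "anc y" "anc x"] card_mono[of "anc y" "anc y \<inter> anc x"] finite_anc
    by (simp add: Int_commute)
  then have "g * (m y / (h * p ^ card (anc y))) * p ^ card (anc y - anc x) =
      g / h * (1 / p ^ card (anc x \<inter> anc y)) * m y"
    using p_pos h0 by (simp add: field_simps power_add)
  then show ?thesis
    unfolding kernel_def coef_def using p_pos assms(1) h0 g h
    by (simp add: ennreal_mult[symmetric] divide_ennreal del: ennreal_mult'')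
qed (simp add: coef_def)

lemma green_mult_coef_coef:
  assumes m: "\<And>y. 0 \<le> m y" "\<And>y. y \<in> A \<Longrightarrow> m y \<noteq> 0 \<Longrightarrow> green K a y \<noteq> 0" and xy: "x \<in> A" "y \<in> A"
  shows "green K a x * green K x y * (coef m x * coef m y * ennreal (p ^ card (anc x \<union> anc y)))
    = kernel x y * ennreal (m x) * ennreal (m y)"
proof -
  have "card (anc x \<union> anc y) = card (anc x) + card (anc y - anc x)"
    using card_Un_disjoint[of "anc x" "anc y - anc x"] finite_anc by simp
  then have "ennreal (p ^ card (anc x \<union> anc y)) = ennreal (p ^ card (anc x)) * ennreal (p ^ card (anc y - anc x))"
    using p_pos by (simp add: power_add ennreal_mult)
  then have "green K a x * green K x y * (coef m x * coef m y * ennreal (p ^ card (anc x \<union> anc y)))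
      = (coef m x * green K a x * ennreal (p ^ card (anc x))) * (green K x y * coef m y * ennreal (p ^ card (anc y - anc x)))"
    by (simp add: mult_ac)
  also have "\<dots> = ennreal (m x) * (kernel x y * ennreal (m y))"
    using m xy by (subst coef_mult_green kernel_mult_coef; simp)+
  finally show ?thesis by (simp add: mult_ac)
qed

lemma mass_first_moment:
  assumes "\<And>y. 0 \<le> m y" "\<And>y. y \<in> A \<Longrightarrow> m y \<noteq> 0 \<Longrightarrow> green K a y \<noteq> 0"
  shows "(\<integral>\<^sup>+w. (\<Sum>r\<in>Pow sites. wt r * mass m r w) \<partial>M) = ennreal (\<Sum>y\<in>A. m y)"
proof -
  have "(\<Sum>r\<in>Pow sites. wt r * mass m r w) = (\<Sum>y\<in>A. visits y w * (coef m y * ennreal (p ^ card (anc y))))" for w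
  proof -
    have "(\<Sum>r\<in>Pow sites. wt r * mass m r w) =
        (\<Sum>y\<in>A. \<Sum>r\<in>Pow sites. visits y w * coef m y * (wt r * of_bool (anc y \<subseteq> r)))"
      unfolding mass_def by (subst sum.swap) (simp add: sum_distrib_left mult_ac)
    also have "\<dots> = (\<Sum>y\<in>A. visits y w * coef m y * ennreal (p ^ card (anc y)))"
      by (intro sum.cong refl) (subst sum_distrib_left[symmetric], subst sum_wt_superset, auto)
    finally show ?thesis by (simp add: mult.assoc)
  qed
  then have "(\<integral>\<^sup>+w. (\<Sum>r\<in>Pow sites. wt r * mass m r w) \<partial>M)
      = (\<Sum>y\<in>A. (\<integral>\<^sup>+w. visits y w \<partial>M) * (coef m y * ennreal (p ^ card (anc y))))"
    by (simp add: nn_integral_sum nn_integral_multc)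
  also have "\<dots> = (\<Sum>y\<in>A. coef m y * green K a y * ennreal (p ^ card (anc y)))"
    by (simp add: nn_integral_visits mult_ac)
  also have "\<dots> = (\<Sum>y\<in>A. ennreal (m y))"
    using assms by (intro sum.cong refl coef_mult_green) auto
  finally show ?thesis using assms(1) by (simp add: sum_ennreal)
qed

text \<open>Joint survival of \<open>x\<close> and \<open>y\<close> has probability
  \<open>p ^ card (anc x \<union> anc y)\<close>, and each of the two orders of visiting them
  contributes one copy of the energy.\<close>

lemma mass_second_moment:
  assumes m: "\<And>y. 0 \<le> m y" "\<And>y. y \<in> A \<Longrightarrow> m y \<noteq> 0 \<Longrightarrow> green K a y \<noteq> 0"
  shows "(\<integral>\<^sup>+w. (\<Sum>r\<in>Pow sites. wt r * (mass m r w)^2) \<partial>M) \<le> 2 * energy m"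
proof -
  let ?c = "\<lambda>x y. coef m x * coef m y * ennreal (p ^ card (anc x \<union> anc y))"
  have "(\<Sum>r\<in>Pow sites. wt r * (mass m r w)^2) = (\<Sum>x\<in>A. \<Sum>y\<in>A. (visits x w * visits y w) * ?c x y)" for w
  proof -
    have "(mass m r w)^2 = (\<Sum>x\<in>A. \<Sum>y\<in>A. (visits x w * visits y w * (coef m x * coef m y)) * of_bool (anc x \<union> anc y \<subseteq> r))" for r
      unfolding mass_def power2_eq_square sum_product
      by (intro sum.cong refl) (simp add: of_bool_conj mult_ac)
    then have "(\<Sum>r\<in>Pow sites. wt r * (mass m r w)^2) = (\<Sum>r\<in>Pow sites. \<Sum>x\<in>A. \<Sum>y\<in>A.
        (visits x w * visits y w * (coef m x * coef m y)) * (wt r * of_bool (anc x \<union> anc y \<subseteq> r)))"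
      by (simp only: sum_distrib_left mult.left_commute)
    also have "\<dots> = (\<Sum>x\<in>A. \<Sum>y\<in>A. \<Sum>r\<in>Pow sites.
        (visits x w * visits y w * (coef m x * coef m y)) * (wt r * of_bool (anc x \<union> anc y \<subseteq> r)))"
      by (subst sum.swap, intro sum.cong refl, rule sum.swap)
    also have "\<dots> = (\<Sum>x\<in>A. \<Sum>y\<in>A. (visits x w * visits y w * (coef m x * coef m y)) * ennreal (p ^ card (anc x \<union> anc y)))"
    proof (intro sum.cong refl)
      fix x y assume "x \<in> A" "y \<in> A"
      then have "anc x \<union> anc y \<subseteq> sites" by auto
      then show "(\<Sum>r\<in>Pow sites. (visits x w * visits y w * (coef m x * coef m y)) * (wt r * of_bool (anc x \<union> anc y \<subseteq> r)))
          = (visits x w * visits y w * (coef m x * coef m y)) * ennreal (p ^ card (anc x \<union> anc y))"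
        by (simp only: sum_distrib_left[symmetric] sum_wt_superset)
    qed
    finally show ?thesis by (simp add: mult.assoc)
  qed
  then have "(\<integral>\<^sup>+w. (\<Sum>r\<in>Pow sites. wt r * (mass m r w)^2) \<partial>M)
      = (\<Sum>x\<in>A. \<Sum>y\<in>A. (\<integral>\<^sup>+w. visits x w * visits y w \<partial>M) * ?c x y)"
    by (simp add: nn_integral_sum nn_integral_multc)
  also have "\<dots> \<le> (\<Sum>x\<in>A. \<Sum>y\<in>A. (green K a x * green K x y + green K a y * green K y x) * ?c x y)"
    by (intro sum_mono mult_right_mono nn_integral_visits_mult_le) auto
  also have "\<dots> = (\<Sum>x\<in>A. \<Sum>y\<in>A. kernel x y * ennreal (m x) * ennreal (m y) + kernel y x * ennreal (m y) * ennreal (m x))"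
  proof (intro sum.cong refl)
    fix x y assume xy: "x \<in> A" "y \<in> A"
    show "(green K a x * green K x y + green K a y * green K y x) * ?c x y
        = kernel x y * ennreal (m x) * ennreal (m y) + kernel y x * ennreal (m y) * ennreal (m x)"
    proof -
      have "green K a x * green K x y * ?c x y = kernel x y * ennreal (m x) * ennreal (m y)"
        using m xy by (intro green_mult_coef_coef) auto
      moreover have "green K a y * green K y x * ?c y x = kernel y x * ennreal (m y) * ennreal (m x)"
        using m xy by (intro green_mult_coef_coef) auto
      moreover have "?c y x = ?c x y" by (simp add: Un_commute mult.commute)
      ultimately show ?thesis by (simp only: distrib_right)
    qed
  qed
  also have "\<dots> = energy m + (\<Sum>x\<in>A. \<Sum>y\<in>A. kernel y x * ennreal (m y) * ennreal (m x))"
    by (simp add: sum.distrib energy_def)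
  also have "(\<Sum>x\<in>A. \<Sum>y\<in>A. kernel y x * ennreal (m y) * ennreal (m x)) = energy m"
    unfolding energy_def by (rule sum.swap)
  finally show ?thesis by (simp add: mult_2)
qed

lemma green_self_nonzero: "green K y y \<noteq> 0"
proof
  assume "green K y y = 0"
  then have "\<forall>n. ennreal (pmf (kstep K n y) y) = 0"
    unfolding green_def by (subst (asm) suminf_eq_zero_iff) (simp_all add: summableI)
  then have "ennreal (pmf (kstep K 0 y) y) = 0" by blast
  then show False by simp
qed

text \<open>The visit at time 0 makes \<open>green K y y\<close> nonzero, so a charged point with
  \<open>green K a y = 0\<close> has an infinite diagonal term.\<close>

lemma energy_finite_imp:
  assumes "energy m \<noteq> \<top>" "y \<in> A" "m y > 0"
  shows "green K a y \<noteq> 0"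
proof
  assume 0: "green K a y = 0"
  have "kernel y y = \<top>"
    unfolding kernel_def 0 using p_pos green_self_nonzero[of y]
    by (simp add: ennreal_divide_eq_top_iff ennreal_mult_eq_top_iff)
  then have "kernel y y * ennreal (m y) * ennreal (m y) = \<top>"
    using assms(3) by (simp add: ennreal_mult_eq_top_iff)
  moreover have "kernel y y * ennreal (m y) * ennreal (m y) \<le> (\<Sum>z\<in>A. kernel y z * ennreal (m y) * ennreal (m z))"
    using assms(2) finite_A by (intro member_le_sum) auto
  moreover have "\<dots> \<le> energy m"
    unfolding energy_def using assms(2) finite_A
    by (intro member_le_sum[of y A "\<lambda>x. \<Sum>z\<in>A. kernel x z * ennreal (m x) * ennreal (m z)"]) auto
  ultimately show False using assms(1) by (auto simp: top_unique)
qed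

lemma hit_prob_le_1: "hit_prob \<le> 1"
proof -
  have "hit_prob \<le> (\<Sum>r\<in>Pow sites. wt r * 1)"
    unfolding hit_prob_def by (intro sum_mono mult_left_mono emeasure_le_1) auto
  also have "\<dots> = 1"
    using sum_wt_mean[of "\<lambda>_. 1"] by (simp add: bern_mean_const finite_sites)
  finally show ?thesis .
qed

lemma nn_integral_hit:
  "(\<integral>\<^sup>+w. (\<Sum>r\<in>Pow sites. wt r * of_bool (\<exists>n. X n w \<in> surv r)) \<partial>M) = hit_prob"
proof -
  have [measurable]: "(\<lambda>w. of_bool (\<exists>n. X n w \<in> surv r) :: ennreal) \<in> borel_measurable M" for r
    unfolding of_bool_def by measurable
  show ?thesis
    unfolding hit_prob_def by (simp add: nn_integral_sum nn_integral_cmult nn_integral_of_bool)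
qed

text \<open>Second moment method, with the Cauchy--Schwarz inequality replaced by
  \<open>2 Z t \<le> Z\<^sup>2 + t\<^sup>2\<close> on the event that \<open>Z = mass m r\<close> is positive, for the optimal \<open>t\<close>.\<close>

lemma hit_prob_lower:
  assumes m: "\<And>y. 0 \<le> m y" "(\<Sum>y\<in>A. m y) = 1" and fin: "energy m \<noteq> \<top>"
  shows "1 \<le> 2 * energy m * hit_prob"
proof -
  have pos: "y \<in> A \<Longrightarrow> m y \<noteq> 0 \<Longrightarrow> green K a y \<noteq> 0" for y
    using energy_finite_imp[OF fin, of y] m(1)[of y] by simp
  have main: "2 * t \<le> 2 * energy m + t^2 * hit_prob" for t
  proof -
    let ?h = "\<lambda>r w. of_bool (\<exists>n. X n w \<in> surv r) :: ennreal"
    have [measurable]: "?h r \<in> borel_measurable M" for r unfolding of_bool_def by measurable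
    \<comment> \<open>Without a hit the mass vanishes, so \<open>t^2\<close> may carry the indicator
      of a hit.\<close>
    have *: "2 * t * mass m r w \<le> (mass m r w)^2 + t^2 * ?h r w" for r w
    proof (cases "\<exists>n. X n w \<in> surv r")
      case True
      then show ?thesis
        using ennreal_two_mult_le_squares[of "mass m r w" t] by (simp add: mult_ac)
    next
      case False
      have "visits y w = 0" if "y \<in> A" "anc y \<subseteq> r" for y
      proof -
        have "X n w \<noteq> y" for n using False that by (auto simp: surv_def)
        then show ?thesis by (simp add: visits_def)
      qed
      then have "mass m r w = 0" unfolding mass_def by (intro sum.neutral) auto
      then show ?thesis by simp
    qed
    have "2 * t = 2 * t * (\<integral>\<^sup>+w. (\<Sum>r\<in>Pow sites. wt r * mass m r w) \<partial>M)"
      using mass_first_moment[of m] m pos by simp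
    also have "\<dots> = (\<integral>\<^sup>+w. 2 * t * (\<Sum>r\<in>Pow sites. wt r * mass m r w) \<partial>M)"
      by (rule nn_integral_cmult[symmetric]) measurable
    also have "\<dots> \<le> (\<integral>\<^sup>+w. (\<Sum>r\<in>Pow sites. wt r * (mass m r w)^2) + t^2 * (\<Sum>r\<in>Pow sites. wt r * ?h r w) \<partial>M)"
    proof (intro nn_integral_mono)
      fix w
      have "2 * t * (\<Sum>r\<in>Pow sites. wt r * mass m r w) = (\<Sum>r\<in>Pow sites. wt r * (2 * t * mass m r w))"
        by (simp add: sum_distrib_left mult_ac)
      also have "\<dots> \<le> (\<Sum>r\<in>Pow sites. wt r * ((mass m r w)^2 + t^2 * ?h r w))"
        by (intro sum_mono mult_left_mono *) auto
      also have "\<dots> = (\<Sum>r\<in>Pow sites. wt r * (mass m r w)^2) + t^2 * (\<Sum>r\<in>Pow sites. wt r * ?h r w)"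
        by (simp add: distrib_left sum.distrib sum_distrib_left mult.left_commute)
      finally show "2 * t * (\<Sum>r\<in>Pow sites. wt r * mass m r w)
          \<le> (\<Sum>r\<in>Pow sites. wt r * (mass m r w)^2) + t^2 * (\<Sum>r\<in>Pow sites. wt r * ?h r w)" .
    qed
    also have "\<dots> = (\<integral>\<^sup>+w. (\<Sum>r\<in>Pow sites. wt r * (mass m r w)^2) \<partial>M) + t^2 * (\<integral>\<^sup>+w. (\<Sum>r\<in>Pow sites. wt r * ?h r w) \<partial>M)"
      by (subst nn_integral_add) (simp_all add: nn_integral_cmult)
    also have "\<dots> \<le> 2 * energy m + t^2 * hit_prob"
      unfolding nn_integral_hit using m pos by (intro add_right_mono mass_second_moment) auto
    finally show ?thesis .
  qed
  obtain e where e: "energy m = ennreal e" "0 \<le> e" using fin by (cases "energy m") auto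
  obtain q where q: "hit_prob = ennreal q" "0 \<le> q" using hit_prob_le_1 by (cases hit_prob) (auto simp: top_unique)
  have q1: "q \<le> 1" using hit_prob_le_1 q by simp
  have real: "2 * t \<le> 2 * e + t^2 * q" if "0 \<le> t" for t
    using main[of "ennreal t"] that e q
    by (simp add: ennreal_mult[symmetric] ennreal_power ennreal_plus[symmetric]
        ennreal_numeral[symmetric] ennreal_le_iff del: ennreal_plus ennreal_numeral)
  \<comment> \<open>The choice \<open>t = 1\<close> with \<open>q \<le> 1\<close> keeps
    \<open>e\<close> away from 0; the choice \<open>t = 2 * e\<close> then gives the bound after
    division by \<open>e\<close>.\<close>
  have "1 \<le> 2 * e" using real[of 1] q1 by simp
  moreover have "2 * e \<le> 4 * e^2 * q" using real[of "2 * e"] e by (simp add: power_mult_distrib)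
  ultimately have "1 \<le> 2 * e * q" by (simp add: power2_eq_square)
  then show ?thesis
    using e q by (simp add: ennreal_mult[symmetric] ennreal_numeral[symmetric] del: ennreal_numeral)
qed

section \<open>The unnormalised law of the first surviving point hit by the chain\<close>

definition first_law :: "'s \<Rightarrow> ennreal" where
  "first_law x = (\<Sum>r\<in>Pow sites. wt r * emeasure M {w\<in>space M. first_hit (surv r) x w})"

lemma sum_first_law: "(\<Sum>x\<in>A. first_law x) = hit_prob"
proof -
  have [measurable]: "(\<lambda>w. of_bool (first_hit (surv r) x w) :: ennreal) \<in> borel_measurable M" for r x
    unfolding of_bool_def by measurable
  have "(\<Sum>x\<in>A. emeasure M {w\<in>space M. first_hit (surv r) x w}) = emeasure M {w\<in>space M. \<exists>n. X n w \<in> surv r}" for r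
  proof -
    have "(\<Sum>x\<in>A. emeasure M {w\<in>space M. first_hit (surv r) x w}) = (\<integral>\<^sup>+w. (\<Sum>x\<in>A. of_bool (first_hit (surv r) x w)) \<partial>M)"
      by (simp add: nn_integral_sum nn_integral_of_bool)
    also have "\<dots> = (\<integral>\<^sup>+w. of_bool (\<exists>n. X n w \<in> surv r) \<partial>M)"
      using finite_A by (subst sum_first_hit) (auto simp: surv_def)
    finally show ?thesis by (simp add: nn_integral_of_bool)
  qed
  then show ?thesis
    unfolding first_law_def hit_prob_def by (subst sum.swap) (simp add: sum_distrib_left[symmetric])
qed

text \<open>A first hit of \<open>x\<close> is itself a visit, so by the strong Markov property with
  \<open>y = x\<close> it is impossible when no visits are expected. Hence the first-hit law charges
  no point where the denominator of \<open>kernel\<close> is 0.\<close>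

lemma first_law_nonzero:
  assumes "first_law x \<noteq> 0"
  shows "green K a x \<noteq> 0"
proof
  assume 0: "green K a x = 0"
  have "emeasure M {w\<in>space M. first_hit B x w} = 0" for B
  proof -
    have "emeasure M {w\<in>space M. first_hit B x w} * green K x x \<le> (\<integral>\<^sup>+w. visits x w * of_bool (first_hit B x w) \<partial>M)"
      by (rule nn_integral_visits_first_hit_ge)
    also have "\<dots> \<le> (\<integral>\<^sup>+w. visits x w \<partial>M)" by (intro nn_integral_mono) auto
    also have "\<dots> = 0" by (simp add: nn_integral_visits 0)
    finally show ?thesis using green_self_nonzero[of x] by simp
  qed
  then have "first_law x = 0" by (simp add: first_law_def)
  with assms show False by simp
qed

text \<open>The two averages are used one at a time. For a fixed path,
  \<open>first_point_energy_le\<close> handles the percolation; for a fixed configuration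
  \<open>r\<close>, the set \<open>surv r\<close> is deterministic and the strong Markov property
  handles the chain.\<close>

lemma first_law_energy_le:
  assumes m: "\<And>y. 0 \<le> m y" "\<And>y. y \<in> A \<Longrightarrow> m y \<noteq> 0 \<Longrightarrow> green K a y \<noteq> 0"
    and le_total: "\<And>x y. x \<in> A \<Longrightarrow> y \<in> A \<Longrightarrow> le x y \<or> le y x"
    and le_trans: "\<And>x y z. x \<in> A \<Longrightarrow> y \<in> A \<Longrightarrow> z \<in> A \<Longrightarrow> le x y \<Longrightarrow> le y z \<Longrightarrow> le x z"
    and le_between: "\<And>x y z. x \<in> A \<Longrightarrow> y \<in> A \<Longrightarrow> z \<in> A \<Longrightarrow> le x y \<Longrightarrow> le y z \<Longrightarrow>
      anc x \<inter> anc z \<subseteq> anc y"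
  shows "2 * t * (\<Sum>x\<in>A. \<Sum>y\<in>A. if le x y then first_law x * (kernel x y * ennreal (m y)) else 0)
    \<le> 2 * energy m + 4 * t^2 * hit_prob"
proof -
  interpret ordered_percolation p sites anc A le
  proof
    show "0 \<le> p" "p \<le> 1" "finite sites" "finite A"
      using p_pos p_le_1 finite_sites finite_A by auto
    show "anc x \<subseteq> sites" if "x \<in> A" for x using that by blast
    show "le x y \<or> le y x" if "x \<in> A" "y \<in> A" for x y
      using that by (rule le_total)
    show "le x z" if "x \<in> A" "y \<in> A" "z \<in> A" "le x y" "le y z" for x y z
      using that by (rule le_trans)
    show "anc x \<inter> anc z \<subseteq> anc y" if "x \<in> A" "y \<in> A" "z \<in> A" "le x y" "le y z" for x y z
      using that by (rule le_between)
  qed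
  have of_bool_meas [measurable]: "(\<lambda>w. of_bool (first_hit (surv r) x w) :: ennreal) \<in> borel_measurable M"
    "(\<lambda>w. of_bool (\<exists>n. X n w \<in> surv r) :: ennreal) \<in> borel_measurable M" for r x
    unfolding of_bool_def by measurable
  define f where "f w x r = (of_bool (first_hit (surv r) x w) :: real)" for w x r
  have enn_of_bool: "ennreal (of_bool b) = of_bool b" for b by (cases b) auto
  define L where "L x y w = (visits y w * coef m y) * ennreal (p ^ card (anc y - anc x) * bern_mean p sites (f w x))" for x y w
  have L: "L x y w = coef m y * ennreal (p ^ card (anc y - anc x)) *
      (\<Sum>r\<in>Pow sites. wt r * (visits y w * of_bool (first_hit (surv r) x w)))" for x y w
  proof -
    have "ennreal (p ^ card (anc y - anc x) * bern_mean p sites (f w x))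
        = ennreal (p ^ card (anc y - anc x)) * (\<Sum>r\<in>Pow sites. wt r * of_bool (first_hit (surv r) x w))"
      using p_pos sum_wt_mean[of "f w x"]
      by (simp add: f_def enn_of_bool ennreal_mult')
    then show ?thesis by (simp add: L_def sum_distrib_left mult_ac)
  qed
  have L_meas [measurable]: "L x y \<in> borel_measurable M" for x y unfolding L by measurable
  \<comment> \<open>Here the configuration is fixed and the path averaged.\<close>
  have int_L: "first_law x * (kernel x y * ennreal (m y)) \<le> (\<integral>\<^sup>+w. L x y w \<partial>M)" if "y \<in> A" for x y
  proof -
    have "first_law x * (kernel x y * ennreal (m y)) =
        first_law x * (green K x y * coef m y * ennreal (p ^ card (anc y - anc x)))"
      using kernel_mult_coef[of m y x] m that by simp
    also have "\<dots> = coef m y * ennreal (p ^ card (anc y - anc x)) *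
        (\<Sum>r\<in>Pow sites. wt r * (emeasure M {w\<in>space M. first_hit (surv r) x w} * green K x y))"
      by (simp add: first_law_def sum_distrib_left sum_distrib_right mult_ac)
    also have "\<dots> \<le> coef m y * ennreal (p ^ card (anc y - anc x)) *
        (\<Sum>r\<in>Pow sites. wt r * (\<integral>\<^sup>+w. visits y w * of_bool (first_hit (surv r) x w) \<partial>M))"
      by (intro mult_left_mono sum_mono nn_integral_visits_first_hit_ge) auto
    also have "\<dots> = (\<integral>\<^sup>+w. L x y w \<partial>M)"
      unfolding L by (simp add: nn_integral_cmult nn_integral_sum)
    finally show ?thesis .
  qed
  have if_meas [measurable]: "(\<lambda>w. if le x y then L x y w else 0) \<in> borel_measurable M" for x y
    by (cases "le x y") auto
  have "2 * t * (\<Sum>x\<in>A. \<Sum>y\<in>A. if le x y then first_law x * (kernel x y * ennreal (m y)) else 0)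
      \<le> 2 * t * (\<Sum>x\<in>A. \<Sum>y\<in>A. \<integral>\<^sup>+w. (if le x y then L x y w else 0) \<partial>M)"
    using int_L by (intro mult_left_mono sum_mono) auto
  also have "\<dots> = (\<integral>\<^sup>+w. 2 * t * (\<Sum>x\<in>A. \<Sum>y\<in>A. if le x y then L x y w else 0) \<partial>M)"
    by (simp add: nn_integral_cmult nn_integral_sum)
  also have "\<dots> \<le> (\<integral>\<^sup>+w. (\<Sum>r\<in>Pow sites. wt r * (mass m r w)^2) +
      t^2 * (4 * (\<Sum>r\<in>Pow sites. wt r * of_bool (\<exists>n. X n w \<in> surv r))) \<partial>M)"
  proof (intro nn_integral_mono)
    fix w
    \<comment> \<open>At most one point is hit first, so the sum is an indicator and equals its
      square.\<close>
    have f_sum: "(\<Sum>x\<in>A. f w x r)^2 = of_bool (\<exists>n. X n w \<in> surv r)" for r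
      unfolding f_def using finite_A by (subst sum_first_hit) (auto simp: surv_def)
    have "ennreal (4 * bern_mean p sites (\<lambda>r. (\<Sum>x\<in>A. f w x r)^2))
        = 4 * (\<Sum>r\<in>Pow sites. wt r * of_bool (\<exists>n. X n w \<in> surv r))"
      unfolding f_sum using sum_wt_mean[of "\<lambda>r. of_bool (\<exists>n. X n w \<in> surv r)"]
      by (simp add: enn_of_bool ennreal_mult')
    moreover have "2 * t * (\<Sum>x\<in>A. \<Sum>y\<in>A. if le x y then L x y w else 0)
      \<le> (\<Sum>r\<in>Pow sites. wt r * (mass m r w)^2) + t^2 * ennreal (4 * bern_mean p sites (\<lambda>r. (\<Sum>x\<in>A. f w x r)^2))"
      unfolding L_def mass_def wt_def
      by (rule first_point_energy_le) (auto simp: f_def first_hit_def surv_def)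
    ultimately show "2 * t * (\<Sum>x\<in>A. \<Sum>y\<in>A. if le x y then L x y w else 0)
      \<le> (\<Sum>r\<in>Pow sites. wt r * (mass m r w)^2) +
      t^2 * (4 * (\<Sum>r\<in>Pow sites. wt r * of_bool (\<exists>n. X n w \<in> surv r)))" by simp
  qed
  also have "\<dots> = (\<integral>\<^sup>+w. (\<Sum>r\<in>Pow sites. wt r * (mass m r w)^2) \<partial>M) +
      t^2 * (4 * (\<integral>\<^sup>+w. (\<Sum>r\<in>Pow sites. wt r * of_bool (\<exists>n. X n w \<in> surv r)) \<partial>M))"
    by (subst nn_integral_add) (simp_all add: nn_integral_cmult)
  also have "\<dots> \<le> 2 * energy m + t^2 * (4 * hit_prob)"
    unfolding nn_integral_hit using m by (intro add_right_mono mass_second_moment) auto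
  finally show ?thesis by (simp add: mult_ac)
qed

text \<open>The witness is \<open>first_law\<close> divided by \<open>hit_prob\<close>, the law of
  the first surviving point hit given that there is a hit. The order by \<open>key\<close> and its
  converse together cover all pairs of points.\<close>

lemma hit_prob_upper:
  fixes key :: "'s \<Rightarrow> 'o :: linorder"
  assumes between: "\<And>x y z. key x \<le> key y \<Longrightarrow> key y \<le> key z \<Longrightarrow> anc x \<inter> anc z \<subseteq> anc y"
    and "hit_prob \<noteq> 0"
  shows "\<exists>m. (\<forall>y. 0 \<le> m y) \<and> (\<forall>y. y \<notin> A \<longrightarrow> m y = 0) \<and> (\<Sum>y\<in>A. m y) = 1 \<and>
    energy m \<noteq> \<top> \<and> hit_prob * energy m \<le> 32"
proof -
  obtain q where q: "hit_prob = ennreal q" "0 \<le> q" using hit_prob_le_1 by (cases hit_prob) (auto simp: top_unique)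
  have q0: "0 < q" using assms(2) q by auto
  have first_le: "first_law x \<le> hit_prob" if "x \<in> A" for x
    unfolding sum_first_law[symmetric] using that finite_A by (intro member_le_sum) auto
  define m where "m x = (if x \<in> A then enn2real (first_law x) / q else 0)" for x
  have m0: "0 \<le> m y" for y using q0 by (simp add: m_def)
  have first_m: "first_law x = hit_prob * ennreal (m x)" if "x \<in> A" for x
  proof -
    have "first_law x < \<top>" using first_le[OF that] q by (simp add: le_less_trans)
    then have "first_law x = ennreal (enn2real (first_law x))" by simp
    also have "\<dots> = ennreal (q * m x)" using that q0 by (simp add: m_def)
    also have "\<dots> = hit_prob * ennreal (m x)" using q by (simp add: ennreal_mult m0)
    finally show ?thesis .
  qed
  have pos: "green K a y \<noteq> 0" if "y \<in> A" "m y \<noteq> 0" for y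
  proof -
    have "first_law y \<noteq> 0" using that q0 by (auto simp: m_def)
    then show ?thesis by (rule first_law_nonzero)
  qed
  have sum_m: "(\<Sum>y\<in>A. m y) = 1"
  proof -
    have "hit_prob * ennreal (\<Sum>y\<in>A. m y) = (\<Sum>y\<in>A. first_law y)"
      using m0 by (simp add: first_m sum_distrib_left[symmetric] sum_ennreal)
    then have "ennreal (q * (\<Sum>y\<in>A. m y)) = ennreal q"
      using q m0 by (simp add: sum_first_law ennreal_mult sum_nonneg)
    then have "q * (\<Sum>y\<in>A. m y) = q" using q0 m0 by (simp add: ennreal_inj sum_nonneg)
    then show ?thesis using q0 by simp
  qed
  have fin: "energy m \<noteq> \<top>"
  proof -
    have "kernel x y * ennreal (m x) * ennreal (m y) \<noteq> \<top>" if "x \<in> A" "y \<in> A" for x y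
      using pos[OF that(2)] transient[of x y]
      by (cases "m y = 0") (auto simp: kernel_def ennreal_mult_eq_top_iff ennreal_divide_eq_top_iff)
    then show ?thesis using finite_A by (simp add: energy_def)
  qed
  have main: "2 * t * (hit_prob * energy m) \<le> 4 * energy m + 8 * t^2 * hit_prob" for t
  proof -
    let ?k = "\<lambda>x y. first_law x * (kernel x y * ennreal (m y))"
    have "hit_prob * energy m = (\<Sum>x\<in>A. \<Sum>y\<in>A. ?k x y)"
      by (simp add: energy_def sum_distrib_left first_m mult_ac)
    \<comment> \<open>Pairs with equal keys, the diagonal among them, are counted twice.\<close>
    also have "\<dots> \<le> (\<Sum>x\<in>A. \<Sum>y\<in>A. (if key x \<le> key y then ?k x y else 0) + (if key y \<le> key x then ?k x y else 0))"
      by (intro sum_mono) auto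
    finally have "2 * t * (hit_prob * energy m) \<le>
        2 * t * (\<Sum>x\<in>A. \<Sum>y\<in>A. if key x \<le> key y then ?k x y else 0) +
        2 * t * (\<Sum>x\<in>A. \<Sum>y\<in>A. if key y \<le> key x then ?k x y else 0)"
      unfolding sum.distrib distrib_left[symmetric] by (intro mult_left_mono) auto
    also have "\<dots> \<le> (2 * energy m + 4 * t^2 * hit_prob) + (2 * energy m + 4 * t^2 * hit_prob)"
    proof (intro add_mono first_law_energy_le m0 pos)
      show "anc x \<inter> anc z \<subseteq> anc y" if "key x \<le> key y" "key y \<le> key z" for x y z
        using between that by blast
      show "anc x \<inter> anc z \<subseteq> anc y" if "key y \<le> key x" "key z \<le> key y" for x y z
        using between[of z y x] that by (simp add: Int_commute)
    qed auto
    also have "\<dots> = (2 + 2) * energy m + (4 + 4) * t^2 * hit_prob"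
      by (simp only: distrib_right add_ac)
    finally show ?thesis by simp
  qed
  obtain e where e: "energy m = ennreal e" "0 \<le> e" using fin by (cases "energy m") auto
  have real: "2 * t * (q * e) \<le> 4 * e + 8 * t^2 * q" if "0 \<le> t" for t
    using main[of "ennreal t"] that e q
    by (simp add: ennreal_mult[symmetric] ennreal_power ennreal_plus[symmetric]
        ennreal_numeral[symmetric] ennreal_le_iff del: ennreal_plus ennreal_numeral)
  have "q * e \<le> 32"
  proof (cases "e = 0")
    case False
    \<comment> \<open>With \<open>t = e / 8\<close> the last term is half of the left-hand side,
      which leaves \<open>q * e^2 / 8 \<le> 4 * e\<close>.\<close>
    have "2 * (e / 8) * (q * e) \<le> 4 * e + 8 * (e / 8)^2 * q" using e by (intro real) simp
    then have "e * (q * e) \<le> e * 32" by (simp add: power2_eq_square field_simps)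
    then show ?thesis using False e by simp
  qed simp
  then have "hit_prob * energy m \<le> 32"
    using e q by (simp add: ennreal_mult[symmetric] ennreal_numeral[symmetric] del: ennreal_numeral)
  then show ?thesis using m0 sum_m fin by (intro exI[of _ m]) (auto simp: m_def)
qed

end

section \<open>Shells and dyadic cubes of the lattice\<close>

lemma latV_mono: "k \<le> l \<Longrightarrow> latV k \<subseteq> latV l"
proof
  fix x :: "int^'d" assume kl: "k \<le> l" and x: "x \<in> latV k"
  from kl have "(2::int) ^ k \<le> 2 ^ l" by (intro power_increasing) auto
  moreover have "- (2 ^ k) \<le> x $ i" "x $ i < 2 ^ k" for i using x by (auto simp: latV_def)
  ultimately have "- (2 ^ l) \<le> x $ i \<and> x $ i < 2 ^ l" for i by (smt (verit))
  then show "x \<in> latV l" by (simp add: latV_def)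
qed

lemma finite_latV: "finite (latV k :: (int^'d) set)"
proof (rule finite_subset)
  show "latV k \<subseteq> (\<lambda>f. \<chi> i. f i) ` (PiE (UNIV :: 'd set) (\<lambda>_. {- (2^k)..<2^k :: int}))"
  proof
    fix x :: "int^'d" assume "x \<in> latV k"
    then have "(\<lambda>i. x $ i) \<in> PiE (UNIV :: 'd set) (\<lambda>_. {- (2^k)..<2^k :: int})"
      by (auto simp: latV_def)
    moreover have "x = (\<chi> i. x $ i)" by simp
    ultimately show "x \<in> (\<lambda>f. \<chi> i. f i) ` (PiE (UNIV :: 'd set) (\<lambda>_. {- (2^k)..<2^k :: int}))"
      by blast
  qed
qed (intro finite_imageI finite_PiE; simp)

lemma ex_latV: "\<exists>k. (x :: int^'d) \<in> latV k"
proof -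
  define k where "k = nat (\<Sum>i\<in>UNIV. \<bar>x $ i\<bar>)"
  have "\<bar>x $ i\<bar> < 2 ^ k" for i
  proof -
    have "\<bar>x $ i\<bar> \<le> (\<Sum>i\<in>UNIV. \<bar>x $ i\<bar>)" by (rule member_le_sum) auto
    also have "\<dots> = int k" by (simp add: k_def sum_nonneg)
    also have "\<dots> < 2 ^ k" by (rule of_nat_less_two_power)
    finally show ?thesis .
  qed
  then have "x \<in> latV k" by (auto simp: latV_def abs_less_iff intro: less_imp_le) (smt (verit))
  then show ?thesis ..
qed

text \<open>Replaces the recursion by a least index, from which existence and uniqueness of the
  shell follow.\<close>

lemma mem_latS_iff: "x \<in> latS k \<longleftrightarrow> x \<in> latV k \<and> (\<forall>j<k. x \<notin> latV j)"
proof (cases k)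
  case (Suc l)
  then show ?thesis using latV_mono[of _ l] by (auto simp: less_Suc_eq_le)
qed simp

lemma latS_unique: "x \<in> latS k \<Longrightarrow> x \<in> latS l \<Longrightarrow> k = l"
  unfolding mem_latS_iff by (metis linorder_neqE_nat)

lemma shell_of_eq: "x \<in> latS k \<Longrightarrow> shell_of x = k"
  unfolding shell_of_def using latS_unique by blast

lemma mem_latS_shell_of: "x \<in> latS (shell_of x)"
proof -
  have "\<exists>k. x \<in> latS k"
    unfolding mem_latS_iff using ex_latV[of x] exists_least_iff[of "\<lambda>k. x \<in> latV k"] by blast
  then show ?thesis using shell_of_eq by metis
qed

lemma same_shell_iff: "same_shell x y \<longleftrightarrow> shell_of x = shell_of y"
  unfolding same_shell_def using shell_of_eq mem_latS_shell_of by metis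

text \<open>The indices of the labels that decide the survival of \<open>x\<close>, listed by level
  \<open>j = k + 1 - i\<close>. The shell in the first component keeps the families of different
  shells apart.\<close>

definition cubes_of :: "int^'d \<Rightarrow> (nat \<times> nat \<times> (int^'d)) set" where
  "cubes_of x = (\<lambda>j. (shell_of x, j, cube_idx j x)) ` {..shell_of x}"

lemma mem_cubes_of: "(k, j, c) \<in> cubes_of x \<longleftrightarrow> k = shell_of x \<and> j \<le> k \<and> c = cube_idx j x"
  by (auto simp: cubes_of_def)

lemma finite_cubes_of: "finite (cubes_of x)"
  by (simp add: cubes_of_def)

text \<open>For \<open>j \<le> k\<close> the bounds of the box \<open>latV k\<close> are multiples
  of \<open>2 ^ j\<close>, so they survive the division.\<close>

lemma cubes_of_sub: "cubes_of x \<subseteq> perc_index"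
proof -
  let ?k = "shell_of x"
  have "- (2 ^ (?k - j)) \<le> cube_idx j x $ i \<and> cube_idx j x $ i < 2 ^ (?k - j)" if "j \<le> ?k" for i j
  proof -
    have x: "- (2 ^ ?k) \<le> x $ i" "x $ i < 2 ^ ?k"
      using mem_latS_shell_of[of x] by (auto simp: mem_latS_iff latV_def)
    have pow: "(2::int) ^ ?k = 2 ^ (?k - j) * 2 ^ j"
      using that by (simp add: power_add[symmetric])
    have "- (2 ^ (?k - j)) = (- (2 ^ (?k - j)) * 2 ^ j) div (2 ^ j :: int)"
      by (subst nonzero_mult_div_cancel_right) auto
    also have "\<dots> \<le> x $ i div 2 ^ j" using x by (intro zdiv_mono1) (auto simp: pow)
    finally have "- (2 ^ (?k - j)) \<le> x $ i div 2 ^ j" .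
    moreover have "x $ i div 2 ^ j < 2 ^ (?k - j)"
    proof (rule ccontr)
      assume "\<not> x $ i div 2 ^ j < 2 ^ (?k - j)"
      then have "2 ^ (?k - j) * 2 ^ j \<le> x $ i div 2 ^ j * 2 ^ j" by (intro mult_right_mono) auto
      also have "\<dots> \<le> x $ i"
      proof -
        have "0 \<le> x $ i mod 2 ^ j" by simp
        then show ?thesis using div_mult_mod_eq[of "x $ i" "2 ^ j"] by linarith
      qed
      finally show False using x by (simp add: pow)
    qed
    ultimately show ?thesis by (simp add: cube_idx_def)
  qed
  then show ?thesis by (auto simp: cubes_of_def perc_index_def)
qed

text \<open>Identifies the exponent in \<open>kernel\<close> with the one in the energies. Within a
  shell the indices correspond by \<open>i = k + 1 - j\<close>; across shells the first components
  differ.\<close>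

lemma card_cubes_of_Int:
  "card (cubes_of x \<inter> cubes_of y) = (if same_shell x y then tree_dist x y else 0)"
proof (cases "same_shell x y")
  case True
  define k where "k = shell_of x"
  have k: "shell_of x = k" "shell_of y = k" using True by (auto simp: k_def same_shell_iff)
  have "cubes_of x \<inter> cubes_of y =
      (\<lambda>i. (k, k + 1 - i, cube_idx (k + 1 - i) x)) ` {i\<in>{1..k + 1}. cube_idx (k + 1 - i) x = cube_idx (k + 1 - i) y}"
    (is "_ = ?f ` ?I")
  proof (intro subset_antisym subsetI)
    fix c assume "c \<in> cubes_of x \<inter> cubes_of y"
    then obtain j where j: "j \<le> k" "c = (k, j, cube_idx j x)" "cube_idx j x = cube_idx j y"
      by (cases c) (auto simp: mem_cubes_of k)
    then have "k + 1 - j \<in> ?I" "c = ?f (k + 1 - j)" by auto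
    then show "c \<in> ?f ` ?I" by blast
  qed (auto simp: mem_cubes_of k)
  moreover have "inj_on ?f ?I" by (auto simp: inj_on_def)
  ultimately have "card (cubes_of x \<inter> cubes_of y) = card ?I" by (simp only: card_image)
  also have "\<dots> = tree_dist x y" by (simp add: tree_dist_def Let_def k)
  finally show ?thesis using True by simp
next
  case False
  then have "cubes_of x \<inter> cubes_of y = {}" by (auto simp: cubes_of_def same_shell_iff)
  with False show ?thesis by simp
qed

text \<open>A half-open unit cube contains no lattice point but its corner, so the union in
  \<open>frac_perc\<close> reduces to the labels of the point itself.\<close>

lemma lat_embed_mem_unit_cube: "lat_embed x \<in> unit_cube y \<longleftrightarrow> x = y"
proof
  assume *: "lat_embed x \<in> unit_cube y"
  have "x $ i = y $ i" for i
  proof -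
    have "real_of_int (y $ i) \<le> real_of_int (x $ i)" "real_of_int (x $ i) < real_of_int (y $ i) + 1"
      using * by (auto simp: lat_embed_def unit_cube_def)
    then show ?thesis by linarith
  qed
  then show "x = y" by (simp add: vec_eq_iff)
qed (simp add: lat_embed_def unit_cube_def)

lemma lat_embed_mem_frac_perc:
  "lat_embed x \<in> frac_perc p U w \<longleftrightarrow> (\<forall>(k, j, c)\<in>cubes_of x. U k j c w < p)"
proof -
  let ?k = "shell_of x"
  have "lat_embed x \<in> frac_perc p U w \<longleftrightarrow>
      (\<exists>y k. lat_embed x \<in> unit_cube y \<and> y \<in> latS k \<and>
        (\<forall>i\<in>{1..k+1}. U k (k+1-i) (cube_idx (k+1-i) y) w < p))"
    unfolding frac_perc_def by blast
  also have "\<dots> \<longleftrightarrow> (\<exists>k. x \<in> latS k \<and> (\<forall>i\<in>{1..k+1}. U k (k+1-i) (cube_idx (k+1-i) x) w < p))"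
    by (simp add: lat_embed_mem_unit_cube)
  also have "\<dots> \<longleftrightarrow> (\<forall>i\<in>{1..?k+1}. U ?k (?k+1-i) (cube_idx (?k+1-i) x) w < p)"
    using mem_latS_shell_of shell_of_eq by metis
  also have "\<dots> \<longleftrightarrow> (\<forall>j\<in>{..?k}. U ?k j (cube_idx j x) w < p)"
  proof (intro iffI ballI)
    fix j assume *: "\<forall>i\<in>{1..?k+1}. U ?k (?k+1-i) (cube_idx (?k+1-i) x) w < p" and j: "j \<in> {..?k}"
    from j have "?k + 1 - j \<in> {1..?k+1}" "?k + 1 - (?k + 1 - j) = j" by auto
    with bspec[OF * this(1)] show "U ?k j (cube_idx j x) w < p" by simp
  qed auto
  finally show ?thesis by (simp add: cubes_of_def)
qed

section \<open>A lexicographic order in which every cube is an interval\<close>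

lemma take_between_lexorder:
  fixes u v s :: "'a :: linorder list"
  assumes "take m u = take m v" "u \<le> s" "s \<le> v"
  shows "take m s = take m u"
  using assms
proof (induction m arbitrary: u v s)
  case (Suc m)
  show ?case
  proof (cases u)
    case Nil
    with Suc.prems show ?thesis by (cases v; cases s) auto
  next
    case (Cons b u')
    with Suc.prems obtain v' where v: "v = b # v'" "take m u' = take m v'" by (cases v) auto
    from Suc.prems Cons v obtain s' where s: "s = b # s'" "u' \<le> s'" "s' \<le> v'"
      by (cases s) auto
    with Suc.IH[OF v(2) s(2,3)] Cons show ?thesis by simp
  qed
qed simp

text \<open>An address: the shell, then the cubes from coarsest to finest. Sharing a cube means
  sharing a prefix, and lists with a given prefix form an interval. Of \<open>to_nat\<close> only
  injectivity matters.\<close>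

definition cube_key :: "int^'d \<Rightarrow> nat list" where
  "cube_key x = shell_of x # map (\<lambda>i. to_nat (cube_idx (shell_of x - i) x)) [0..<Suc (shell_of x)]"

lemma cubes_of_between:
  assumes "cube_key x \<le> cube_key y" "cube_key y \<le> cube_key z"
  shows "cubes_of x \<inter> cubes_of z \<subseteq> cubes_of y"
proof
  fix q assume "q \<in> cubes_of x \<inter> cubes_of z"
  then obtain k j c where q: "q = (k, j, c)" and k: "shell_of x = k" "shell_of z = k"
    and j: "j \<le> k" and c: "cube_idx j x = c" "cube_idx j z = c"
    by (cases q) (auto simp: mem_cubes_of)
  \<comment> \<open>Dyadic cubes are nested: a common cube of level \<open>j\<close> forces common
    cubes at all coarser levels.\<close>
  have coarse: "cube_idx l x = cube_idx l z" if "j \<le> l" for l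
  proof -
    have "cube_idx l v = cube_idx (l - j) (cube_idx j v)" for v :: "int^'a"
      using that by (simp add: cube_idx_def vec_eq_iff zdiv_zmult2_eq[symmetric] power_add[symmetric])
    then show ?thesis using c by metis
  qed
  \<comment> \<open>One entry for the shell and \<open>k - j + 1\<close> entries for the levels
    \<open>k\<close> down to \<open>j\<close>.\<close>
  define m where "m = Suc (Suc (k - j))"
  have key_nth: "take m (cube_key v) ! Suc (k - j) = to_nat (cube_idx j v)"
    if "shell_of v = k" for v :: "int^'a"
    using that j by (auto simp: cube_key_def m_def nth_append simp del: upt_Suc)
  have "take m (cube_key x) = take m (cube_key z)"
    unfolding cube_key_def m_def using k j coarse
    by (auto simp: take_map take_upt simp del: upt_Suc)
  then have y: "take m (cube_key y) = take m (cube_key x)"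
    using assms by (rule take_between_lexorder)
  then have "shell_of y = k" by (simp add: cube_key_def m_def k)
  moreover from this have "cube_idx j y = c"
    using y key_nth[of x] key_nth[of y] k c by simp
  ultimately show "q \<in> cubes_of y" using j by (simp add: q mem_cubes_of)
qed

section \<open>Macroscopic percolation\<close>

lemma inverse_le_if_one_le_mult_ennreal:
  fixes x y :: ennreal
  assumes "1 \<le> x * y" "y \<noteq> \<top>"
  shows "inverse y \<le> x"
proof -
  have "y \<noteq> 0" using assms(1) by (cases "y = 0") auto
  have "inverse y \<le> x * y * inverse y" using assms(1) mult_right_mono[of 1 "x * y" "inverse y"] by simp
  also have "\<dots> = x * (y / y)" by (simp add: divide_ennreal_def mult.assoc)
  also have "\<dots> = x" using \<open>y \<noteq> 0\<close> assms(2) by (simp add: ennreal_divide_self less_top)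
  finally show ?thesis .
qed

lemma inverse_inverse_ennreal: "inverse (inverse x) = (x :: ennreal)"
proof (cases x)
  case (real r)
  then show ?thesis by (cases "r = 0") (auto simp: inverse_ennreal)
qed simp

lemma inverse_antimono_ennreal:
  fixes x y :: ennreal
  assumes "x \<le> y"
  shows "inverse y \<le> inverse x"
proof (cases "x = 0 \<or> y = \<top>")
  case False
  then obtain r s where "x = ennreal r" "y = ennreal s" "0 < r" "0 < s"
    using assms by (cases x; cases y) (auto simp: top_unique less_le)
  with assms show ?thesis by (simp add: inverse_ennreal)
qed auto

locale macroscopic_percolation = markov_chain M X K a
  for M :: "'w measure" and X :: "nat \<Rightarrow> 'w \<Rightarrow> int^'d" and K :: "int^'d \<Rightarrow> (int^'d) pmf" and a :: "int^'d" +
  fixes U :: "nat \<Rightarrow> nat \<Rightarrow> int^'d \<Rightarrow> 'w \<Rightarrow> real" and p :: real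
  assumes transient: "\<And>x y. green K x y \<noteq> \<top>"
    and U_meas: "\<forall>(k,j,c)\<in>perc_index. U k j c \<in> borel_measurable M"
    and U_unif: "\<forall>(k,j,c)\<in>perc_index. distr M lborel (U k j c) = uniform_measure lborel {0<..<1::real}"
    and U_indep: "indep_vars (\<lambda>_. borel) (\<lambda>(k,j,c). U k j c) perc_index"
    and XU_indep: "indep_set
        {(\<lambda>w n. X n w) -` A \<inter> space M | A. A \<in> sets (PiM UNIV (\<lambda>_::nat. count_space UNIV))}
        {(\<lambda>w. \<lambda>(k,j,c)\<in>perc_index. U k j c w) -` B \<inter> space M | B.
            B \<in> sets (PiM perc_index (\<lambda>_. borel :: real measure))}"
    and p: "0 < p" "p \<le> 1"
begin

definition label :: "nat \<times> nat \<times> (int^'d) \<Rightarrow> 'w \<Rightarrow> real" where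
  "label = (\<lambda>(k, j, c). U k j c)"

definition hit_event :: "(int^'d) set \<Rightarrow> 'w set" where
  "hit_event F = {w\<in>space M. \<exists>n. lat_embed (X n w) \<in> frac_perc p U w \<and> X n w \<in> F}"

lemma label_measurable: "q \<in> perc_index \<Longrightarrow> label q \<in> borel_measurable M"
  using U_meas by (auto simp: label_def)

lemma prob_label:
  assumes "q \<in> perc_index"
  shows "prob (label q -` {..<p} \<inter> space M) = p" "prob (label q -` {p..} \<inter> space M) = 1 - p"
proof -
  have meas: "label q \<in> measurable M lborel" using label_measurable[OF assms] by simp
  have eq: "emeasure M (label q -` B \<inter> space M) = emeasure lborel ({0<..<1} \<inter> B)" if "B \<in> sets borel" for B
  proof -
    have "emeasure M (label q -` B \<inter> space M) = emeasure (distr M lborel (label q)) B"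
      using meas that by (subst emeasure_distr) auto
    also have "distr M lborel (label q) = uniform_measure lborel {0<..<1}"
      using U_unif assms by (auto simp: label_def)
    also have "emeasure \<dots> B = emeasure lborel ({0<..<1} \<inter> B)"
      using that by (subst emeasure_uniform_measure) (auto simp: divide_ennreal_def)
    finally show ?thesis .
  qed
  have "{0<..<1} \<inter> {..<p} = {0<..<p}" "{0<..<1} \<inter> {p..} = {p..<1}" using p by auto
  then show "prob (label q -` {..<p} \<inter> space M) = p" "prob (label q -` {p..} \<inter> space M) = 1 - p"
    using eq[of "{..<p}"] eq[of "{p..}"] p by (simp_all add: measure_def)
qed

lemma prob_label_pattern:
  assumes "finite C" "C \<subseteq> perc_index"
  shows "prob {w\<in>space M. \<forall>q\<in>C. label q w < p \<longleftrightarrow> q \<in> r} = bern_weight p C r"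
proof (cases "C = {}")
  case False
  let ?B = "\<lambda>q. if q \<in> r then {..<p} else {p..}"
  have "{w\<in>space M. \<forall>q\<in>C. label q w < p \<longleftrightarrow> q \<in> r} = (\<Inter>q\<in>C. label q -` ?B q \<inter> space M)"
    using False by (auto split: if_splits simp: not_less)
  also have "prob \<dots> = (\<Prod>q\<in>C. prob (label q -` ?B q \<inter> space M))"
    using U_indep False assms unfolding label_def by (intro indep_varsD) auto
  also have "\<dots> = bern_weight p C r"
    unfolding bern_weight_def using assms prob_label by (intro prod.cong) auto
  finally show ?thesis .
qed (simp add: bern_weight_def prob_space)

lemma prob_X_label_pattern:
  assumes "finite C" "C \<subseteq> perc_index"
  shows "{w\<in>space M. (\<exists>n. X n w \<in> S) \<and> (\<forall>q\<in>C. label q w < p \<longleftrightarrow> q \<in> r)} \<in> sets M"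
    and "prob {w\<in>space M. (\<exists>n. X n w \<in> S) \<and> (\<forall>q\<in>C. label q w < p \<longleftrightarrow> q \<in> r)}
      = bern_weight p C r * prob {w\<in>space M. \<exists>n. X n w \<in> S}"
proof -
  let ?PX = "PiM (UNIV :: nat set) (\<lambda>_. count_space UNIV :: (int^'d) measure)"
  let ?PU = "PiM (perc_index :: (nat \<times> nat \<times> (int^'d)) set) (\<lambda>_. borel :: real measure)"
  let ?u = "\<lambda>w. \<lambda>(k,j,c)\<in>perc_index. U k j c w"
  define E1 where "E1 = {w\<in>space M. \<exists>n. X n w \<in> S}"
  define E2 where "E2 = {w\<in>space M. \<forall>q\<in>C. label q w < p \<longleftrightarrow> q \<in> r}"
  have "{f\<in>space ?PX. \<exists>n. f n \<in> S} \<in> sets ?PX" by measurable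
  moreover have "E1 = (\<lambda>w n. X n w) -` {f\<in>space ?PX. \<exists>n. f n \<in> S} \<inter> space M"
    by (auto simp: E1_def space_PiM)
  ultimately have E1: "E1 \<in> {(\<lambda>w n. X n w) -` A \<inter> space M | A. A \<in> sets ?PX}" by blast
  have "{g\<in>space ?PU. \<forall>q\<in>C. g q < p \<longleftrightarrow> q \<in> r} \<in> sets ?PU"
  proof -
    have "Measurable.pred ?PU (\<lambda>g. g q < p \<longleftrightarrow> q \<in> r)" if "q \<in> C" for q
    proof -
      have [measurable]: "(\<lambda>g. g q) \<in> borel_measurable ?PU"
        using that assms(2) by (intro measurable_component_singleton) auto
      show ?thesis by measurable
    qed
    then have "Measurable.pred ?PU (\<lambda>g. \<forall>q\<in>C. g q < p \<longleftrightarrow> q \<in> r)"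
      using assms(1) by (intro pred_intros_finite) auto
    then show ?thesis by simp
  qed
  moreover have "E2 = ?u -` {g\<in>space ?PU. \<forall>q\<in>C. g q < p \<longleftrightarrow> q \<in> r} \<inter> space M"
  proof -
    have "?u w q = label q w" if "q \<in> C" for w q
      using that assms(2) by (auto simp: label_def split_def)
    then show ?thesis by (auto simp: E2_def space_PiM)
  qed
  ultimately have E2: "E2 \<in> {?u -` B \<inter> space M | B. B \<in> sets ?PU}" by blast
  have eq: "{w\<in>space M. (\<exists>n. X n w \<in> S) \<and> (\<forall>q\<in>C. label q w < p \<longleftrightarrow> q \<in> r)} = E1 \<inter> E2"
    by (auto simp: E1_def E2_def)
  show "{w\<in>space M. (\<exists>n. X n w \<in> S) \<and> (\<forall>q\<in>C. label q w < p \<longleftrightarrow> q \<in> r)} \<in> sets M"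
    unfolding eq using indep_setD_ev1[OF XU_indep] indep_setD_ev2[OF XU_indep] E1 E2 by blast
  show "prob {w\<in>space M. (\<exists>n. X n w \<in> S) \<and> (\<forall>q\<in>C. label q w < p \<longleftrightarrow> q \<in> r)}
      = bern_weight p C r * prob {w\<in>space M. \<exists>n. X n w \<in> S}"
    unfolding eq using indep_setD[OF XU_indep E1 E2] prob_label_pattern[OF assms]
    by (simp add: E1_def E2_def mult.commute)
qed

lemma percolated_chain_cubes_of: "finite A \<Longrightarrow> percolated_chain M X K a p cubes_of A"
  using p transient finite_cubes_of
  by unfold_locales auto

text \<open>Only the finitely many labels in \<open>sites\<close> matter. The event splits into
  disjoint pieces according to which of them are below \<open>p\<close>; on each piece the surviving
  set is fixed, and independence of chain and labels gives its probability.\<close>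

lemma
  assumes "finite A"
  shows hit_event_finite_sets: "hit_event A \<in> sets M"
    and emeasure_hit_event_finite: "emeasure M (hit_event A) = percolated_chain.hit_prob M X p cubes_of A"
proof -
  interpret percolated_chain M X K a p cubes_of A
    using assms by (rule percolated_chain_cubes_of)
  have sub: "sites \<subseteq> perc_index" using cubes_of_sub by blast
  define E where "E r = {w\<in>space M. (\<exists>n. X n w \<in> surv r) \<and> (\<forall>q\<in>sites. label q w < p \<longleftrightarrow> q \<in> r)}" for r
  have "hit_event A = (\<Union>r\<in>Pow sites. E r)"
  proof (intro subset_antisym subsetI)
    fix w assume "w \<in> hit_event A"
    then obtain n where n: "X n w \<in> A" "\<forall>q\<in>cubes_of (X n w). label q w < p" and w: "w \<in> space M"
      by (auto simp: hit_event_def lat_embed_mem_frac_perc label_def split_def)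
    then have "w \<in> E {q\<in>sites. label q w < p}" by (auto simp: E_def surv_def)
    then show "w \<in> (\<Union>r\<in>Pow sites. E r)" by (rule UN_I[rotated]) auto
  next
    fix w assume "w \<in> (\<Union>r\<in>Pow sites. E r)"
    then obtain r n where w: "w \<in> space M" and n: "X n w \<in> A" "cubes_of (X n w) \<subseteq> r"
      and r: "\<forall>q\<in>sites. label q w < p \<longleftrightarrow> q \<in> r"
      by (auto simp: E_def surv_def)
    then have "\<forall>q\<in>cubes_of (X n w). label q w < p" by blast
    then show "w \<in> hit_event A"
      using w n by (auto simp: hit_event_def lat_embed_mem_frac_perc label_def split_def)
  qed
  moreover have E_sets: "E r \<in> sets M" for r
    unfolding E_def using finite_sites sub by (rule prob_X_label_pattern)
  ultimately show "hit_event A \<in> sets M" using finite_sites by auto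
  have "disjoint_family_on E (Pow sites)" by (auto simp: disjoint_family_on_def E_def)
  then have "emeasure M (\<Union>r\<in>Pow sites. E r) = (\<Sum>r\<in>Pow sites. emeasure M (E r))"
    using E_sets finite_sites by (intro sum_emeasure[symmetric]) auto
  also have "\<dots> = hit_prob"
    unfolding hit_prob_def E_def wt_def using prob_X_label_pattern(2)[OF finite_sites sub] p
    by (intro sum.cong) (auto simp: emeasure_eq_measure ennreal_mult bern_weight_nonneg)
  finally show "emeasure M (hit_event A) = hit_prob" using \<open>hit_event A = _\<close> by simp
qed

lemma energy_I_plus_energy_Ip:
  assumes "finite A"
  shows "energy_I K \<mu> a A + energy_Ip p K \<mu> a A = percolated_chain.energy K a p cubes_of A (pmf \<mu>)"
proof -
  interpret percolated_chain M X K a p cubes_of A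
    using assms by (rule percolated_chain_cubes_of)
  show ?thesis
    unfolding energy_I_def energy_Ip_def energy_def kernel_def sum.distrib[symmetric]
    by (intro sum.cong refl) (simp add: card_cubes_of_Int)
qed

text \<open>The form with \<open>inverse\<close> also covers hitting probability 0, where it says
  that the energy is infinite.\<close>

lemma inverse_hit_event_le_energy:
  assumes "finite A" "set_pmf \<mu> \<subseteq> A"
  shows "inverse (2 * emeasure M (hit_event A)) \<le> energy_I K \<mu> a A + energy_Ip p K \<mu> a A"
proof -
  interpret percolated_chain M X K a p cubes_of A
    using assms(1) by (rule percolated_chain_cubes_of)
  show ?thesis
    unfolding energy_I_plus_energy_Ip[OF assms(1)] emeasure_hit_event_finite[OF assms(1)]
  proof (cases "energy (pmf \<mu>) = \<top>")
    case False
    have "1 \<le> 2 * energy (pmf \<mu>) * hit_prob"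
      using False assms by (intro hit_prob_lower) (auto simp: sum_pmf_eq_1)
    moreover have "2 * hit_prob \<noteq> \<top>"
      using hit_prob_le_1 by (auto simp: ennreal_mult_eq_top_iff top_unique)
    ultimately show "inverse (2 * hit_prob) \<le> energy (pmf \<mu>)"
      by (intro inverse_le_if_one_le_mult_ennreal) (auto simp: mult_ac)
  qed simp
qed

text \<open>The nonzero probability permits conditioning on a hit, which is how
  \<open>hit_prob_upper\<close> finds its measure.\<close>

lemma hit_event_le_inverse_energy:
  assumes "finite A" "emeasure M (hit_event A) \<noteq> 0"
  obtains \<mu> where "set_pmf \<mu> \<subseteq> A"
    "emeasure M (hit_event A) \<le> 32 * inverse (energy_I K \<mu> a A + energy_Ip p K \<mu> a A)"
proof -
  interpret percolated_chain M X K a p cubes_of A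
    using assms(1) by (rule percolated_chain_cubes_of)
  have "hit_prob \<noteq> 0" using assms by (simp add: emeasure_hit_event_finite)
  then obtain m where m: "\<And>y. 0 \<le> m y" "\<And>y. y \<notin> A \<Longrightarrow> m y = 0" "(\<Sum>y\<in>A. m y) = 1"
    "energy m \<noteq> \<top>" "hit_prob * energy m \<le> 32"
    using hit_prob_upper[of cube_key] cubes_of_between by blast
  have "(\<integral>\<^sup>+x. ennreal (m x) \<partial>count_space UNIV) = (\<Sum>x\<in>A. ennreal (m x))"
    using assms(1) m by (intro nn_integral_count_space'[of A]) auto
  also have "\<dots> = 1" using m by (simp add: sum_ennreal)
  finally have pmf_m: "pmf (embed_pmf m) x = m x" for x
    using m(1) by (intro pmf_embed_pmf) auto
  have "set_pmf (embed_pmf m) \<subseteq> A" using m(2) by (fastforce simp: set_pmf_iff pmf_m)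
  moreover have "hit_prob \<le> 32 * inverse (energy m)"
  proof (cases "energy m = 0")
    case False
    then have "hit_prob = hit_prob * (energy m / energy m)"
      using m(4) by (simp add: ennreal_divide_self less_top)
    also have "\<dots> = hit_prob * energy m * inverse (energy m)"
      by (simp add: divide_ennreal_def mult.assoc)
    also have "\<dots> \<le> 32 * inverse (energy m)" using m(5) by (intro mult_right_mono) auto
    finally show ?thesis .
  qed (simp add: ennreal_mult_top)
  moreover have "pmf (embed_pmf m) = m" by (auto simp: pmf_m)
  ultimately show ?thesis
    using that[of "embed_pmf m"] assms(1)
    by (simp add: energy_I_plus_energy_Ip emeasure_hit_event_finite)
qed

section \<open>From finite targets to arbitrary targets\<close>

lemma hit_event_UN_latV: "hit_event F = (\<Union>N. hit_event (F \<inter> latV N))"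
  using ex_latV by (fastforce simp: hit_event_def)

lemma hit_event_sets: "hit_event F \<in> sets M"
  by (subst hit_event_UN_latV) (auto intro: hit_event_finite_sets finite_latV)

lemma hit_event_mono: "F \<subseteq> G \<Longrightarrow> hit_event F \<subseteq> hit_event G"
  by (auto simp: hit_event_def)

lemma martin_cap_le: "ennreal (1/2) * martin_cap p K F a \<le> emeasure M (hit_event F)"
proof -
  have "inverse (INF \<mu>\<in>{\<mu>. set_pmf \<mu> \<subseteq> A}. energy_I K \<mu> a A + energy_Ip p K \<mu> a A) \<le> 2 * emeasure M (hit_event F)"
    if A: "A \<subseteq> F" "finite A" for A
  proof -
    have "inverse (2 * emeasure M (hit_event A)) \<le> (INF \<mu>\<in>{\<mu>. set_pmf \<mu> \<subseteq> A}. energy_I K \<mu> a A + energy_Ip p K \<mu> a A)"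
      using A by (intro INF_greatest inverse_hit_event_le_energy) auto
    then have "inverse (INF \<mu>\<in>{\<mu>. set_pmf \<mu> \<subseteq> A}. energy_I K \<mu> a A + energy_Ip p K \<mu> a A)
        \<le> inverse (inverse (2 * emeasure M (hit_event A)))"
      by (rule inverse_antimono_ennreal)
    also have "\<dots> = 2 * emeasure M (hit_event A)" by (rule inverse_inverse_ennreal)
    also have "\<dots> \<le> 2 * emeasure M (hit_event F)"
      using A by (intro mult_left_mono emeasure_mono hit_event_mono hit_event_sets) auto
    finally show ?thesis .
  qed
  then have "martin_cap p K F a \<le> 2 * emeasure M (hit_event F)"
    unfolding martin_cap_def by (intro SUP_least) auto
  then have "ennreal (1/2) * martin_cap p K F a \<le> ennreal (1/2) * (2 * emeasure M (hit_event F))"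
    by (intro mult_left_mono) auto
  also have "\<dots> = ennreal (1/2 * 2) * emeasure M (hit_event F)"
    by (simp only: ennreal_mult' ennreal_numeral mult.assoc)
  finally show ?thesis by simp
qed

lemma emeasure_hit_event_finite_le:
  assumes "finite A" "A \<subseteq> F"
  shows "emeasure M (hit_event A) \<le> 128 * martin_cap p K F a"
proof (cases "emeasure M (hit_event A) = 0")
  case False
  then obtain \<mu> where \<mu>: "set_pmf \<mu> \<subseteq> A"
    "emeasure M (hit_event A) \<le> 32 * inverse (energy_I K \<mu> a A + energy_Ip p K \<mu> a A)"
    using hit_event_le_inverse_energy[OF assms(1)] by blast
  have "inverse (energy_I K \<mu> a A + energy_Ip p K \<mu> a A)
      \<le> inverse (INF \<mu>\<in>{\<mu>. set_pmf \<mu> \<subseteq> A}. energy_I K \<mu> a A + energy_Ip p K \<mu> a A)"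
    using \<mu>(1) by (intro inverse_antimono_ennreal INF_lower) auto
  also have "\<dots> \<le> martin_cap p K F a"
    unfolding martin_cap_def using assms by (intro SUP_upper) auto
  \<comment> \<open>The constant 32 is relaxed to 128.\<close>
  finally have "32 * inverse (energy_I K \<mu> a A + energy_Ip p K \<mu> a A) \<le> 128 * martin_cap p K F a"
    by (intro mult_mono) auto
  with \<mu>(2) show ?thesis by (rule order_trans)
qed simp

text \<open>The bound for \<open>F \<inter> latV N\<close> is uniform in \<open>N\<close>, so
  continuity of the measure from below carries it to \<open>F\<close>.\<close>

lemma emeasure_hit_event_le: "emeasure M (hit_event F) \<le> 128 * martin_cap p K F a"
proof -
  have "incseq (\<lambda>N. hit_event (F \<inter> latV N))"
    by (intro incseq_SucI hit_event_mono Int_mono latV_mono) simp_all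
  then have "emeasure M (hit_event F) = (SUP N. emeasure M (hit_event (F \<inter> latV N)))"
    by (subst hit_event_UN_latV, intro SUP_emeasure_incseq[symmetric]) (auto simp: hit_event_sets)
  also have "\<dots> \<le> 128 * martin_cap p K F a"
    by (intro SUP_least emeasure_hit_event_finite_le) (auto simp: finite_latV)
  finally show ?thesis .
qed

end

theorem theorem5p1:
  fixes M :: "'w measure"
    and K :: "int^'d \<Rightarrow> (int^'d) pmf"
    and X :: "nat \<Rightarrow> 'w \<Rightarrow> int^'d"
    and U :: "nat \<Rightarrow> nat \<Rightarrow> int^'d \<Rightarrow> 'w \<Rightarrow> real"
    and p :: real and F :: "(int^'d) set" and a :: "int^'d"
  assumes "prob_space M"
    and transient: "\<forall>x y. green K x y \<noteq> \<top>"
    and X_meas: "\<forall>n. X n \<in> measurable M (count_space UNIV)"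
    and X_start: "AE w in M. X 0 w = a"
    and markov: "\<forall>n (xs :: nat \<Rightarrow> int^'d) y.
        measure M {w\<in>space M. (\<forall>i\<le>n. X i w = xs i) \<and> X (Suc n) w = y}
        = measure M {w\<in>space M. \<forall>i\<le>n. X i w = xs i} * pmf (K (xs n)) y"
    and U_meas: "\<forall>(k,j,c)\<in>perc_index. U k j c \<in> borel_measurable M"
    and U_unif: "\<forall>(k,j,c)\<in>perc_index.
        distr M lborel (U k j c) = uniform_measure lborel {0<..<1::real}"
    and U_indep: "prob_space.indep_vars M (\<lambda>_. borel) (\<lambda>(k,j,c). U k j c) perc_index"
    and XU_indep: "prob_space.indep_set M
        {(\<lambda>w n. X n w) -` A \<inter> space M | A. A \<in> sets (PiM UNIV (\<lambda>_::nat. count_space UNIV))}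
        {(\<lambda>w. \<lambda>(k,j,c)\<in>perc_index. U k j c w) -` B \<inter> space M | B.
            B \<in> sets (PiM perc_index (\<lambda>_. borel :: real measure))}"
    and "0 < p" and "p \<le> 1"
  shows "ennreal (1/2) * martin_cap p K F a
           \<le> emeasure M {w\<in>space M. \<exists>n. lat_embed (X n w) \<in> frac_perc p U w \<and> X n w \<in> F}
       \<and> emeasure M {w\<in>space M. \<exists>n. lat_embed (X n w) \<in> frac_perc p U w \<and> X n w \<in> F}
           \<le> 128 * martin_cap p K F a"
proof -
  interpret prob_space M by fact
  interpret macroscopic_percolation M X K a U p
  proof
    show "X n \<in> measurable M (count_space UNIV)" for n using X_meas by blast
    show "AE w in M. X 0 w = a" by fact
    show "measure M {w\<in>space M. (\<forall>i\<le>n. X i w = xs i) \<and> X (Suc n) w = y}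
        = measure M {w\<in>space M. \<forall>i\<le>n. X i w = xs i} * pmf (K (xs n)) y" for n xs y
      using markov by blast
    show "green K x y \<noteq> \<top>" for x y using transient by blast
  qed fact+
  show ?thesis
    using martin_cap_le[of F] emeasure_hit_event_le[of F] by (simp only: hit_event_def)
qed

end
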